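(* For integers $s,t\ge 1$ and $n>s+t$, with $N=n+2s+t$, $$n_{1,3}(s,t,n)=\binom{N-1}{s-1} f_{(n-1,s+t)}.$$
   Context: A continuous multiline queue of type $(s,t,n-s-t)$ is a three-row array whose rows are strictly increasing sequences $a_1<\cdots<a_s$, $b_1<\cdots<b_{s+t}$, $c_1<\cdots<c_n$, whose $N=n+2s+t$ entries are exactly $1,\ldots,N$, each once. Bully path procedure: initially all entries are available. First, each entry of row 1 starts a bully path; then each still-available entry of row 2 starts a bully path. An entry $x$ on a path bullies the smallest available entry of the next row larger than $x$, or, if there is none, the smallest available entry of the next row (a wrapping); bullied entries become unavailable and the path continues to row 3. Endpoints of paths starting in row 1 get label 1, those starting in row 2 get label 2, remaining entries of row 3 get label 3. The projected word is $\omega=(\omega_1,\ldots,\omega_n)$, $\omega_k$ being the label of $c_k$. $n_{x,y}(s,t,n)$ denotes the number of continuous multiline queues of type $(s,t,n-s-t)$ with $c_n=N$ whose projected word satisfies $\omega_1=x$, $\omega_2=y$. $f_{(a,b)}$ denotes the number of standard Young tableaux of shape $(a,b)$, $a\ge b\ge0$; it equals $\frac{a-b+1}{a+1}\binom{a+b}{a}$. *)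

theory Defs
  imports Complex_Main
begin

(* A continuous multiline queue of type (s, t, n - s - t) is given by its rows a, b, c.
   Lists are indexed from 0, so the entry c_k is c ! (k - 1). *)
definition is_cmq :: "nat \<Rightarrow> nat \<Rightarrow> nat \<Rightarrow> nat list \<times> nat list \<times> nat list \<Rightarrow> bool" where
  "is_cmq s t n = (\<lambda>(a, b, c).
     length a = s \<and> length b = s + t \<and> length c = n \<and>
     sorted_wrt (<) a \<and> sorted_wrt (<) b \<and> sorted_wrt (<) c \<and>
     distinct (a @ b @ c) \<and> set (a @ b @ c) = {1..n + 2 * s + t})"

(* The entry bullied by x when A is the (finite, nonempty) set of available entries of the
   next row; the second branch is a wrapping. *)
definition bullied :: "nat set \<Rightarrow> nat \<Rightarrow> nat" where
  "bullied A x = (if \<exists>y\<in>A. x < y then Min {y \<in> A. x < y} else Min A)"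

(* One path started by x in row 1, acting on the available entries (B, C) of rows 2 and 3. *)
definition path_from_row1 :: "nat \<Rightarrow> nat set \<times> nat set \<Rightarrow> nat set \<times> nat set" where
  "path_from_row1 x = (\<lambda>(B, C).
     let y = bullied B x; z = bullied C y in (B - {y}, C - {z}))"

definition path_from_row2 :: "nat \<Rightarrow> nat set \<Rightarrow> nat set" where
  "path_from_row2 y C = C - {bullied C y}"

(* Paths starting in the same row are run from left to right; the labels do not depend on
   this choice. *)
definition after_row1 :: "nat list \<times> nat list \<times> nat list \<Rightarrow> nat set \<times> nat set" where
  "after_row1 = (\<lambda>(a, b, c). fold path_from_row1 a (set b, set c))"

definition after_row2 :: "nat list \<times> nat list \<times> nat list \<Rightarrow> nat set" where
  "after_row2 q = (case after_row1 q of (B, C) \<Rightarrow>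
     fold path_from_row2 (sorted_list_of_set B) C)"

(* The label of an entry z of row 3: it became unavailable during the first phase,
   during the second phase, or not at all. *)
definition label :: "nat list \<times> nat list \<times> nat list \<Rightarrow> nat \<Rightarrow> nat" where
  "label q z =
     (if z \<notin> snd (after_row1 q) then 1 else if z \<notin> after_row2 q then 2 else 3)"

definition projected_word :: "nat list \<times> nat list \<times> nat list \<Rightarrow> nat list" where
  "projected_word = (\<lambda>(a, b, c). map (label (a, b, c)) c)"

definition num_cmq :: "nat \<Rightarrow> nat \<Rightarrow> nat \<Rightarrow> nat \<Rightarrow> nat \<Rightarrow> nat" where
  "num_cmq x y s t n = card {(a, b, c).
     is_cmq s t n (a, b, c) \<and> c ! (n - 1) = n + 2 * s + t \<and>
     projected_word (a, b, c) ! 0 = x \<and> projected_word (a, b, c) ! 1 = y}"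

(* Standard Young tableaux of two-row shape (k, l), k \<ge> l, given by their rows. *)
definition is_syt2 :: "nat \<Rightarrow> nat \<Rightarrow> nat list \<times> nat list \<Rightarrow> bool" where
  "is_syt2 k l = (\<lambda>(p, q).
     length p = k \<and> length q = l \<and>
     sorted_wrt (<) p \<and> sorted_wrt (<) q \<and> (\<forall>i<l. p ! i < q ! i) \<and>
     distinct (p @ q) \<and> set (p @ q) = {1..k + l})"

definition num_syt2 :: "nat \<Rightarrow> nat \<Rightarrow> nat" where
  "num_syt2 k l = card {T. is_syt2 k l T}"

end

theory Submission
  imports Defs
begin

text \<open>
  Put the entries on a circle and read it backwards starting at \<open>c\<^sub>2\<close>, writing \<open>a\<close>, \<open>b\<close>, \<open>c\<close> for the row
  of each entry. Since \<open>c\<^sub>2\<close> has label 3, no path wraps past it, so the word has the form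
  \<open>c a\<^sup>i c w\<close>, and \<open>c w\<close> has at least as many \<open>c\<close> as \<open>b\<close> in every prefix. Since row 1 is shorter than
  row 2, wrapping paths from row 1 are irrelevant to the label of \<open>c\<^sub>1\<close>: it is 1 iff some prefix of \<open>w\<close>
  has one more \<open>b\<close> than \<open>c\<close> and each of its \<open>b\<close> is matched, as an opening bracket, by a later \<open>a\<close>.

  Changing the \<open>b\<close> of the first such prefix that is unmatched by \<open>c\<close> into a \<open>c\<close>, and then the last
  unmatched \<open>a\<close> into a \<open>b\<close> (two crystal operators), turns these \<open>w\<close> bijectively into all words with one
  \<open>a\<close> less and one \<open>c\<close> more whose \<open>b\<close> and \<open>c\<close> form a ballot word. In the words \<open>a\<^sup>i c w\<close> so obtained
  the \<open>s - 1\<close> letters \<open>a\<close> occupy arbitrary positions among \<open>N - 1\<close>, and the rest is a ballot word, that is,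
  a standard Young tableau of shape \<open>(n - 1, s + t)\<close>.
\<close>

section \<open>Unmatched entries on the circle\<close>

definition arc :: "nat \<Rightarrow> nat \<Rightarrow> nat set" where
  "arc p z = {k. if p \<le> z then p \<le> k \<and> k \<le> z else p \<le> k \<or> k \<le> z}"

text \<open>\<^term>\<open>arc p z\<close> is the cyclic interval from \<^term>\<open>p\<close> up to \<^term>\<open>z\<close>. The set of entries left over
  by a round of bullying does not depend on the order of the moves: \<^term>\<open>z\<close> survives iff every arc
  ending at \<^term>\<open>z\<close> contains fewer bullies than entries of the next row.\<close>

definition unmatched :: "nat set \<Rightarrow> nat set \<Rightarrow> nat set \<Rightarrow> nat \<Rightarrow> bool" where
  "unmatched P A B z = (\<forall>p\<in>P. card (A \<inter> arc p z) < card (B \<inter> arc p z))"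

lemma end_in_arc [simp]: "z \<in> arc p z"
  by (auto simp: arc_def)

lemma start_in_arc [simp]: "p \<in> arc p z"
  by (auto simp: arc_def)

text \<open>The second part says that the victim is the first entry of \<open>B\<close> met when
  going around the circle from \<open>x\<close>. This covers the ordinary and the wrapping branch of
  \<open>bullied\<close> at once, so the matching argument need not distinguish them.\<close>

lemma bullied_props:
  assumes "finite B" "B \<noteq> {}" "x \<notin> B"
  shows "bullied B x \<in> B" "B \<inter> arc x (bullied B x) = {bullied B x}"
proof -
  have *: "bullied B x \<in> B \<and> B \<inter> arc x (bullied B x) = {bullied B x}"
  proof (cases "\<exists>y\<in>B. x < y")
    case True
    define y where "y = bullied B x"
    have y: "y = Min {y \<in> B. x < y}"
      using True by (simp add: y_def bullied_def)
    have "finite {y \<in> B. x < y}" "{y \<in> B. x < y} \<noteq> {}"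
      using assms True by auto
    then have "y \<in> {y \<in> B. x < y}" "\<And>u. u \<in> B \<Longrightarrow> x < u \<Longrightarrow> y \<le> u"
      unfolding y by (rule Min_in, simp add: Min_le)
    then show ?thesis
      using assms(3) unfolding y_def[symmetric] arc_def by (fastforce simp: le_less)
  next
    case False
    define y where "y = bullied B x"
    have y: "y = Min B"
      using False by (simp add: y_def bullied_def)
    have "y \<in> B" "\<And>u. u \<in> B \<Longrightarrow> y \<le> u"
      using assms unfolding y by auto
    then show ?thesis
      using assms(3) False unfolding y_def[symmetric] arc_def
      by (auto simp: not_less dest: le_antisym)
  qed
  then show "bullied B x \<in> B" "B \<inter> arc x (bullied B x) = {bullied B x}"
    by auto
qed

text \<open>If \<open>y\<close> came after the end of the arc, then \<open>z\<close>, lying on the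
  arc after \<open>x\<close>, would be an entry of \<open>B\<close> strictly before
  \<open>y\<close>.\<close>

lemma arc_first_mem:
  assumes "B \<inter> arc x y = {y}" "z \<in> B" "x \<in> arc p z" "x \<noteq> z"
  shows "y \<in> arc p z"
proof (rule ccontr)
  assume "y \<notin> arc p z"
  then have "z \<in> arc x y"
    using assms(3,4) by (auto simp: arc_def split: if_splits)
  then have "z = y"
    using assms by blast
  then show False
    using \<open>y \<notin> arc p z\<close> by simp
qed

text \<open>Around the circle the order is \<open>x\<close>, \<open>p\<close>, \<open>y\<close>,
  \<open>z\<close>, so moving the start of the arc back from \<open>p\<close> to \<open>x\<close>
  only adds points strictly before \<open>y\<close>.\<close>

lemma arc_diff_subset:
  assumes "y \<in> arc p z" "x \<notin> arc p z"
  shows "arc p z \<subseteq> arc x z" "arc x z - arc p z \<subseteq> arc x y - {y}"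
proof -
  have *: "(k \<in> arc p z \<longrightarrow> k \<in> arc x z) \<and> (k \<in> arc x z \<longrightarrow> k \<notin> arc p z \<longrightarrow> k \<in> arc x y \<and> k \<noteq> y)" for k
  proof (cases "p \<le> z")
    case True
    then have "p \<le> y" "y \<le> z" "x < p \<or> z < x"
      using assms by (auto simp: arc_def)
    then show ?thesis
      using True by (elim disjE) (auto simp: arc_def)
  next
    case False
    then have "p \<le> y \<or> y \<le> z" "x < p" "z < x"
      using assms by (auto simp: arc_def)
    then show ?thesis
      using False by (elim disjE) (auto simp: arc_def)
  qed
  then show "arc p z \<subseteq> arc x z" "arc x z - arc p z \<subseteq> arc x y - {y}"
    by blast+
qed

lemma card_Int_remove:
  assumes "finite A" "x \<in> A"
  shows "card (A \<inter> X) = card ((A - {x}) \<inter> X) + (if x \<in> X then 1 else 0)"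
proof (cases "x \<in> X")
  case True
  then have "A \<inter> X = insert x ((A - {x}) \<inter> X)"
    using assms by auto
  moreover have "finite ((A - {x}) \<inter> X)" "x \<notin> (A - {x}) \<inter> X"
    using assms by auto
  ultimately show ?thesis
    using True by simp
next
  case False
  then have "A \<inter> X = (A - {x}) \<inter> X"
    by auto
  then show ?thesis
    using False by simp
qed

text \<open>One move removes the bully \<open>x\<close> and its victim \<open>y\<close>. An arc
  ending at \<open>z\<close> that contains \<open>x\<close> also contains \<open>y\<close>, so slack
  is lost only on arcs with \<open>y\<close> but without \<open>x\<close>. For these, the arc from
  \<open>x\<close> to \<open>z\<close> has the same entries of \<open>B\<close> and at least one
  more of \<open>A\<close>, which supplies the missing unit; \<open>A \<subseteq> P\<close> makes it
  one of the tested arcs.\<close>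

lemma unmatched_step:
  assumes fin: "finite A" "finite B" and disj: "A \<inter> B = {}" and sub: "A \<subseteq> P"
    and x: "x \<in> A" and y: "y \<in> B" "B \<inter> arc x y = {y}" and z: "z \<in> B"
  shows "unmatched P A B z \<longleftrightarrow> z \<noteq> y \<and> unmatched P (A - {x}) (B - {y}) z"
proof
  assume un: "unmatched P A B z"
  have "x \<in> P"
    using sub x by auto
  have neq: "z \<noteq> y"
  proof
    assume "z = y"
    then have "card (A \<inter> arc x y) < 1"
      using un y \<open>x \<in> P\<close> unfolding unmatched_def by force
    moreover have "x \<in> A \<inter> arc x y"
      using x by simp
    ultimately show False
      using fin by (auto simp: card_eq_0_iff)
  qed
  have "card ((A - {x}) \<inter> arc p z) < card ((B - {y}) \<inter> arc p z)" if p: "p \<in> P" for p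
  proof (cases "y \<in> arc p z \<and> x \<notin> arc p z")
    case True
    then have sub': "arc p z \<subseteq> arc x z" "arc x z - arc p z \<subseteq> arc x y - {y}"
      using arc_diff_subset[of y p z x] by auto
    then have B: "B \<inter> arc x z = B \<inter> arc p z"
      using y(2) by blast
    have "insert x (A \<inter> arc p z) \<subseteq> A \<inter> arc x z"
      using x sub' by auto
    then have "card (insert x (A \<inter> arc p z)) \<le> card (A \<inter> arc x z)"
      using fin by (intro card_mono) auto
    then have "card (A \<inter> arc p z) + 1 \<le> card (A \<inter> arc x z)"
      using True fin by simp
    also have "\<dots> < card (B \<inter> arc p z)"
      using un \<open>x \<in> P\<close> unfolding unmatched_def B[symmetric] by blast
    finally show ?thesis
      using True card_Int_remove[OF fin(1) x, of "arc p z"]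
        card_Int_remove[OF fin(2) y(1), of "arc p z"] by simp
  next
    case False
    have "card (A \<inter> arc p z) < card (B \<inter> arc p z)"
      using un p unfolding unmatched_def by blast
    then show ?thesis
      using False card_Int_remove[OF fin(1) x, of "arc p z"]
        card_Int_remove[OF fin(2) y(1), of "arc p z"] by (auto split: if_splits)
  qed
  then show "z \<noteq> y \<and> unmatched P (A - {x}) (B - {y}) z"
    using neq by (simp add: unmatched_def)
next
  assume *: "z \<noteq> y \<and> unmatched P (A - {x}) (B - {y}) z"
  have "x \<noteq> z"
    using x z disj by auto
  have "card (A \<inter> arc p z) < card (B \<inter> arc p z)" if p: "p \<in> P" for p
  proof -
    have "card ((A - {x}) \<inter> arc p z) < card ((B - {y}) \<inter> arc p z)"
      using * p unfolding unmatched_def by blast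
    moreover have "x \<in> arc p z \<Longrightarrow> y \<in> arc p z"
      using arc_first_mem[OF y(2) z] \<open>x \<noteq> z\<close> by blast
    ultimately show ?thesis
      using card_Int_remove[OF fin(1) x, of "arc p z"]
        card_Int_remove[OF fin(2) y(1), of "arc p z"] by auto
  qed
  then show "unmatched P A B z"
    by (simp add: unmatched_def)
qed

text \<open>A single function models a round of bullying between any two consecutive rows: it is
  used below for row 1 acting on row 2 as well as for row 2 acting on row 3. The bound on
  \<open>length xs\<close> keeps an entry available at every move.\<close>

lemma fold_path_from_row2:
  assumes "finite B" "distinct xs" "set xs \<inter> B = {}" "length xs \<le> card B" "set xs \<subseteq> P"
  shows "fold path_from_row2 xs B = {z \<in> B. unmatched P (set xs) B z}"
  using assms
proof (induction xs arbitrary: B)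
  case Nil
  have "B \<inter> arc p z \<noteq> {}" if "z \<in> B" for p z
    using that end_in_arc[of z p] by blast
  then show ?case
    using Nil by (auto simp: unmatched_def card_gt_0_iff)
next
  case (Cons x xs)
  define y where "y = bullied B x"
  have "B \<noteq> {}"
    using Cons.prems by auto
  then have y: "y \<in> B" "B \<inter> arc x y = {y}"
    using bullied_props[of B x] Cons.prems unfolding y_def by auto
  have "fold path_from_row2 (x # xs) B = fold path_from_row2 xs (B - {y})"
    by (simp add: path_from_row2_def y_def)
  also have "\<dots> = {z \<in> B - {y}. unmatched P (set xs) (B - {y}) z}"
    using Cons.prems y by (intro Cons.IH) auto
  also have "\<dots> = {z \<in> B. unmatched P (set (x # xs)) B z}"
  proof -
    have "set (x # xs) - {x} = set xs"
      using Cons.prems by auto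
    then show ?thesis
      using unmatched_step[of "set (x # xs)" B P x y] Cons.prems y by auto
  qed
  finally show ?case .
qed

text \<open>The first phase interleaves moves on rows 2 and 3, but the moves on row 2 never look at
  row 3. It therefore splits into a full round of \<open>xs\<close> on \<open>B\<close>, followed by
  a round on \<open>C\<close> whose bullies \<open>ys\<close> are the entries of \<open>B\<close>
  hit in the first round.\<close>

lemma fold_path_from_row1:
  assumes "finite B" "distinct xs" "set xs \<inter> B = {}" "length xs \<le> card B"
  shows "\<exists>ys. distinct ys \<and> set ys = B - fold path_from_row2 xs B \<and> fold path_from_row2 xs B \<subseteq> B \<and>
    length ys = length xs \<and>
    fold path_from_row1 xs (B, C) = (fold path_from_row2 xs B, fold path_from_row2 ys C)"
  using assms
proof (induction xs arbitrary: B C)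
  case Nil
  then show ?case
    by auto
next
  case (Cons x xs)
  define y where "y = bullied B x"
  have "B \<noteq> {}"
    using Cons.prems by auto
  then have y: "y \<in> B"
    using bullied_props[of B x] Cons.prems unfolding y_def by auto
  have "\<exists>ys. distinct ys \<and> set ys = B - {y} - fold path_from_row2 xs (B - {y}) \<and>
    fold path_from_row2 xs (B - {y}) \<subseteq> B - {y} \<and> length ys = length xs \<and>
    fold path_from_row1 xs (B - {y}, C - {bullied C y}) =
      (fold path_from_row2 xs (B - {y}), fold path_from_row2 ys (C - {bullied C y}))"
    using Cons.prems y by (intro Cons.IH) auto
  then obtain ys where ys: "distinct ys" "set ys = B - {y} - fold path_from_row2 xs (B - {y})"
    "fold path_from_row2 xs (B - {y}) \<subseteq> B - {y}" "length ys = length xs"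
    "fold path_from_row1 xs (B - {y}, C - {bullied C y}) =
      (fold path_from_row2 xs (B - {y}), fold path_from_row2 ys (C - {bullied C y}))"
    by blast
  have 1: "fold path_from_row2 (x # xs) B = fold path_from_row2 xs (B - {y})"
    by (simp add: path_from_row2_def y_def)
  have 2: "fold path_from_row2 (y # ys) C = fold path_from_row2 ys (C - {bullied C y})"
    by (simp add: path_from_row2_def)
  have 3: "fold path_from_row1 (x # xs) (B, C) = fold path_from_row1 xs (B - {y}, C - {bullied C y})"
    by (simp add: path_from_row1_def y_def Let_def)
  have "set (y # ys) = B - fold path_from_row2 xs (B - {y})" "distinct (y # ys)"
    using ys(1-3) y by auto
  then show ?case
    unfolding 1 3 ys(5) 2[symmetric] using ys(3,4) by (intro exI[of _ "y # ys"]) auto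
qed

text \<open>For label 1, the bullies of row 3 in the first phase are the matched entries of row 2.
  For label 3, the two phases on row 3 together form one round in which all of row 2
  bullies.\<close>

lemma label_iff:
  assumes q: "is_cmq s t n (a, b, c)" and n: "n > s + t" and z: "z \<in> set c"
    and P: "P = {1..n + 2 * s + t}"
  shows "label (a, b, c) z = 1 \<longleftrightarrow>
      \<not> unmatched P {y \<in> set b. \<not> unmatched P (set a) (set b) y} (set c) z"
    and "label (a, b, c) z = 3 \<longleftrightarrow> unmatched P (set b) (set c) z"
proof -
  have q': "length a = s" "length b = s + t" "length c = n" "distinct a" "distinct b" "distinct c"
    "set a \<inter> set b = {}" "set b \<inter> set c = {}" "set a \<union> set b \<union> set c = P"
    using q P by (auto simp: is_cmq_def)
  have cards: "card (set b) = s + t" "card (set c) = n"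
    using q' by (simp_all add: distinct_card)
  define B2 where "B2 = fold path_from_row2 a (set b)"
  have B2: "B2 = {y \<in> set b. unmatched P (set a) (set b) y}"
    unfolding B2_def using q' cards by (intro fold_path_from_row2) auto
  obtain ys where ys: "distinct ys" "set ys = set b - B2"
    "fold path_from_row1 a (set b, set c) = (B2, fold path_from_row2 ys (set c))"
    using fold_path_from_row1[of "set b" a "set c"] q' cards unfolding B2_def by auto
  have ys': "set ys = {y \<in> set b. \<not> unmatched P (set a) (set b) y}"
    unfolding ys B2 by auto
  have lys: "length ys = card (set b - B2)"
    using ys by (metis distinct_card)
  have finB2: "finite B2" "B2 \<subseteq> set b"
    unfolding B2 by auto
  define zs where "zs = ys @ sorted_list_of_set B2"
  have zs: "distinct zs" "set zs = set b"
    using ys finB2 unfolding zs_def by auto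
  then have lzs: "length zs = s + t"
    using cards by (metis distinct_card)
  have C1: "fold path_from_row2 ys (set c) = {z \<in> set c. unmatched P (set ys) (set c) z}"
    using q' ys cards lys n lzs zs_def by (intro fold_path_from_row2) auto
  have C2: "fold path_from_row2 zs (set c) = {z \<in> set c. unmatched P (set b) (set c) z}"
    using q' zs cards lzs n by (subst zs(2)[symmetric], intro fold_path_from_row2) auto
  have 1: "snd (after_row1 (a, b, c)) = {z \<in> set c. unmatched P (set ys) (set c) z}"
    by (simp add: after_row1_def ys C1)
  have 2: "after_row2 (a, b, c) = {z \<in> set c. unmatched P (set b) (set c) z}"
    using C2 by (simp add: after_row2_def after_row1_def ys zs_def)
  \<comment> \<open>Label 3 asks for survival of both phases, and an entry surviving all bullies
    also survives those of the first phase.\<close>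
  have mono: "unmatched P (set ys) (set c) z" if "unmatched P (set b) (set c) z"
  proof -
    have "card (set ys \<inter> arc p z) \<le> card (set b \<inter> arc p z)" for p
      using ys by (intro card_mono) auto
    then show ?thesis
      using that unfolding unmatched_def by (meson le_less_trans)
  qed
  show "label (a, b, c) z = 1 \<longleftrightarrow>
      \<not> unmatched P {y \<in> set b. \<not> unmatched P (set a) (set b) y} (set c) z"
    unfolding label_def 1 2 ys'[symmetric] using z by auto
  show "label (a, b, c) z = 3 \<longleftrightarrow> unmatched P (set b) (set c) z"
    unfolding label_def 1 2 using z mono by auto
qed

section \<open>Exchanging letters in ballot words\<close>

datatype row = Ra | Rb | Rc

definition cnt :: "row \<Rightarrow> row list \<Rightarrow> nat \<Rightarrow> int" where
  "cnt x w j = (\<Sum>i<j. of_bool (w ! i = x))"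

definition height :: "row list \<Rightarrow> nat \<Rightarrow> int" where
  "height w j = cnt Rc w j - cnt Rb w j"

definition surplus :: "row list \<Rightarrow> nat \<Rightarrow> int" where
  "surplus w j = cnt Ra w j - cnt Rb w j"

definition ballot :: "row list \<Rightarrow> bool" where
  "ballot w = (\<forall>j\<le>length w. 0 \<le> height w j)"

text \<open>Read backwards from \<open>c\<^sub>2\<close>, a queue with labels 1, 3 at \<open>c\<^sub>1, c\<^sub>2\<close> is a word \<open>c a\<^sup>i c w\<close>; the
  following is the resulting condition on \<^term>\<open>w\<close>. The index \<^term>\<open>l\<close> ends a stretch whose row-2 entries
  outnumber its row-3 entries, so that one of them bullies \<open>c\<^sub>1\<close>, and the inequality on
  \<^const>\<open>surplus\<close> says that all of these row-2 entries lie on paths from row 1.\<close>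

definition good :: "row list \<Rightarrow> bool" where
  "good w = ((\<forall>j\<le>length w. -1 \<le> height w j) \<and>
     (\<exists>l\<le>length w. height w l = -1 \<and>
       (\<forall>j\<le>l. \<exists>q. l \<le> q \<and> q \<le> length w \<and> surplus w j \<le> surplus w q)))"

section \<open>Prefix counts and their behaviour under a change of one letter\<close>

lemma cnt_0 [simp]: "cnt x w 0 = 0"
  by (simp add: cnt_def)

lemma cnt_Suc [simp]: "cnt x w (Suc j) = cnt x w j + of_bool (w ! j = x)"
  by (simp add: cnt_def)

lemma cnt_list_update:
  assumes "p < length w"
  shows "cnt x (w[p := y]) j = cnt x w j + (if p < j then of_bool (y = x) - of_bool (w ! p = x) else 0)"
  using assms by (induction j) (auto simp: nth_list_update less_Suc_eq)

lemma height_0 [simp]: "height w 0 = 0"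
  by (simp add: height_def)

lemma surplus_0 [simp]: "surplus w 0 = 0"
  by (simp add: surplus_def)

lemma height_Suc: "height w (Suc j) = height w j + (of_bool (w ! j = Rc) - of_bool (w ! j = Rb))"
  by (simp add: height_def)

lemma surplus_Suc: "surplus w (Suc j) = surplus w j + (of_bool (w ! j = Ra) - of_bool (w ! j = Rb))"
  by (simp add: surplus_def)

text \<open>\<^term>\<open>r\<close> and \<^term>\<open>p\<close> are the positions at which the crystal raising operators for the letter pairs
  \<open>b \<rightarrow> c\<close> and then \<open>a \<rightarrow> b\<close> act: the first passage of \<^const>\<open>height\<close> to -1, and the first maximum of
  \<^const>\<open>surplus\<close> after the first change. In \<open>bwd\<close> they are the positions for the inverse lowering
  operators: the last maximum of \<^const>\<open>surplus\<close>, then the last zero of \<^const>\<open>height\<close>.\<close>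

definition fwd :: "row list \<Rightarrow> nat \<Rightarrow> nat \<Rightarrow> bool" where
  "fwd w r p = (r < p \<and> p < length w \<and> w ! r = Rb \<and> w ! p = Ra \<and>
     (\<forall>j\<le>length w. -1 \<le> height w j) \<and> height w (Suc r) = -1 \<and> (\<forall>j\<le>r. 0 \<le> height w j) \<and>
     (\<forall>j\<le>p. surplus (w[r := Rc]) j < surplus (w[r := Rc]) (Suc p)) \<and>
     (\<forall>j\<le>length w. surplus (w[r := Rc]) j \<le> surplus (w[r := Rc]) (Suc p)))"

definition bwd :: "row list \<Rightarrow> nat \<Rightarrow> nat \<Rightarrow> bool" where
  "bwd v r p = (r < p \<and> p < length v \<and> v ! r = Rc \<and> v ! p = Rb \<and> ballot v \<and>
     (\<forall>j\<le>length v. surplus v j \<le> surplus v p) \<and>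
     (\<forall>j. p < j \<and> j \<le> length v \<longrightarrow> surplus v j < surplus v p) \<and>
     height (v[p := Ra]) r = 0 \<and>
     (\<forall>j. r < j \<and> j \<le> length v \<longrightarrow> 1 \<le> height (v[p := Ra]) j))"

section \<open>Existence of the two exchange positions\<close>

lemma first_argmax:
  fixes f :: "nat \<Rightarrow> int"
  obtains p where "p \<le> n" "\<And>j. j \<le> n \<Longrightarrow> f j \<le> f p" "\<And>j. j < p \<Longrightarrow> f j < f p"
proof -
  have fin: "finite (f ` {..n})" "f ` {..n} \<noteq> {}"
    by auto
  define m where "m = Max (f ` {..n})"
  define p where "p = (LEAST p. p \<le> n \<and> f p = m)"
  have "\<exists>p. p \<le> n \<and> f p = m"
    using Max_in[OF fin] unfolding m_def[symmetric] by auto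
  then have p: "p \<le> n \<and> f p = m"
    unfolding p_def by (rule LeastI_ex)
  have le: "f j \<le> f p" if "j \<le> n" for j
    using that Max_ge[OF fin(1)] p unfolding m_def by auto
  have "f j < f p" if "j < p" for j
    using le[of j] not_less_Least[of j "\<lambda>p. p \<le> n \<and> f p = m"] that p unfolding p_def[symmetric]
    by fastforce
  then show ?thesis
    using that p le by blast
qed

lemma last_argmax:
  fixes f :: "nat \<Rightarrow> int"
  obtains p where "p \<le> n" "\<And>j. j \<le> n \<Longrightarrow> f j \<le> f p" "\<And>j. p < j \<Longrightarrow> j \<le> n \<Longrightarrow> f j < f p"
proof -
  obtain p where p: "p \<le> n" "\<And>j. j \<le> n \<Longrightarrow> f (n - j) \<le> f (n - p)"
    "\<And>j. j < p \<Longrightarrow> f (n - j) < f (n - p)"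
    using first_argmax[of n "\<lambda>j. f (n - j)"] by blast
  show ?thesis
  proof (rule that[of "n - p"])
    show "f j \<le> f (n - p)" if "j \<le> n" for j
      using p(2)[of "n - j"] that by simp
    show "f j < f (n - p)" if "n - p < j" "j \<le> n" for j
      using p(3)[of "n - j"] that p(1) by simp
  qed simp
qed

lemma good_imp_fwd:
  assumes "good w"
  shows "\<exists>r p. fwd w r p"
proof -
  define n where "n = length w"
  have H: "\<And>j. j \<le> n \<Longrightarrow> -1 \<le> height w j"
    using assms by (auto simp: good_def n_def)
  obtain l0 where l0: "l0 \<le> n" "height w l0 = -1"
    "\<And>j. j \<le> l0 \<Longrightarrow> \<exists>q. l0 \<le> q \<and> q \<le> n \<and> surplus w j \<le> surplus w q"
    using assms by (auto simp: good_def n_def)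
  \<comment> \<open>\<open>good\<close> supplies some index \<open>l0\<close> of height -1; the
    exchange takes place at the first such index, which may be earlier.\<close>
  define l where "l = (LEAST l. height w l = -1)"
  have l: "height w l = -1"
    unfolding l_def using l0(2) by (rule LeastI)
  have "l \<le> l0"
    unfolding l_def using l0(2) by (rule Least_le)
  have before: "0 \<le> height w j" if "j < l" for j
    using H[of j] not_less_Least[of j "\<lambda>l. height w l = -1"] that \<open>l \<le> l0\<close> l0(1)
    unfolding l_def[symmetric] by fastforce
  have "l \<noteq> 0"
    using l by (metis height_0 zero_neq_neg_one)
  then obtain r where r: "l = Suc r"
    using not0_implies_Suc by blast
  have wr: "w ! r = Rb"
    using l before[of r] unfolding r height_Suc by (cases "w ! r") auto
  have rn: "r < n"
    using r \<open>l \<le> l0\<close> l0(1) by simp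
  define w1 where "w1 = w[r := Rc]"
  have S1: "surplus w1 j = surplus w j + (if r < j then 1 else 0)" for j
    using rn wr unfolding w1_def n_def surplus_def by (simp add: cnt_list_update)
  obtain q where q: "q \<le> n" "\<And>j. j \<le> n \<Longrightarrow> surplus w1 j \<le> surplus w1 q"
    "\<And>j. j < q \<Longrightarrow> surplus w1 j < surplus w1 q"
    using first_argmax[of n "surplus w1"] by blast
  \<comment> \<open>For a maximum at \<open>q \<le> r\<close>, goodness gives some
    \<open>q' \<ge> l0\<close> with at least the same surplus in \<open>w\<close>, and beyond
    \<open>r\<close> the exchange has raised the surplus by 1.\<close>
  have "r < q"
  proof (rule ccontr)
    assume "\<not> r < q"
    then have "q \<le> l0"
      using r \<open>l \<le> l0\<close> by simp
    then obtain q' where "l0 \<le> q'" "q' \<le> n" "surplus w q \<le> surplus w q'"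
      using l0(3) by blast
    then show False
      using q(2)[of q'] S1[of q] S1[of q'] \<open>\<not> r < q\<close> \<open>l \<le> l0\<close> r by simp
  qed
  \<comment> \<open>Letter \<open>r\<close> is now \<open>Rc\<close>, so the surplus is constant
    across it, while it must increase strictly into its first maximum.\<close>
  moreover have "q \<noteq> Suc r"
  proof
    assume "q = Suc r"
    then have "surplus w1 r < surplus w1 (Suc r)"
      using q(3)[of r] by simp
    then show False
      using wr surplus_Suc[of w r] by (simp add: S1)
  qed
  ultimately obtain p where p: "q = Suc p" "r < p"
    by (metis Suc_lessE less_Suc_eq not_less_eq)
  have "w1 ! p = Ra"
    using q(3)[of p] p unfolding p(1) surplus_Suc by (cases "w1 ! p") auto
  then have "w ! p = Ra"
    using p by (simp add: w1_def)
  then have "fwd w r p"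
    unfolding fwd_def using p q wr H before l r w1_def n_def by (auto simp: less_Suc_eq_le)
  then show ?thesis
    by blast
qed

text \<open>Since the surplus ends below its initial value 0, its last maximum is not at the end,
  and the next letter is \<open>Rb\<close>. Changing that letter to \<open>Ra\<close> makes all
  heights after \<open>p\<close> positive, so the last zero of the height lies before
  \<open>p\<close> and is followed by \<open>Rc\<close>.\<close>

lemma ballot_imp_bwd:
  assumes "ballot v" "surplus v (length v) < 0"
  shows "\<exists>r p. bwd v r p"
proof -
  define n where "n = length v"
  have H: "\<And>j. j \<le> n \<Longrightarrow> 0 \<le> height v j"
    using assms by (auto simp: ballot_def n_def)
  obtain p where p: "p \<le> n" "\<And>j. j \<le> n \<Longrightarrow> surplus v j \<le> surplus v p"
    "\<And>j. p < j \<Longrightarrow> j \<le> n \<Longrightarrow> surplus v j < surplus v p"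
    using last_argmax[of n "surplus v"] by blast
  have "p \<noteq> n"
    using p(2)[of 0] assms(2) n_def by auto
  then have pn: "p < n"
    using p(1) by simp
  have vp: "v ! p = Rb"
    using p(3)[of "Suc p"] pn by (cases "v ! p") (auto simp: surplus_Suc)
  define v1 where "v1 = v[p := Ra]"
  have H1: "height v1 j = height v j + (if p < j then 1 else 0)" for j
    using pn vp unfolding v1_def n_def height_def by (simp add: cnt_list_update)
  \<comment> \<open>This is the last minimum of the height; its value is 0 because the height starts
    at 0 and is nonnegative.\<close>
  obtain r where r: "r \<le> n" "\<And>j. j \<le> n \<Longrightarrow> - height v1 j \<le> - height v1 r"
    "\<And>j. r < j \<Longrightarrow> j \<le> n \<Longrightarrow> - height v1 j < - height v1 r"
    using last_argmax[of n "\<lambda>j. - height v1 j"] by blast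
  have v1pos: "0 \<le> height v1 j" if "j \<le> n" for j
    using H[OF that] by (simp add: H1)
  have r0: "height v1 r = 0"
    using r(2)[of 0] v1pos[OF r(1)] by simp
  have pos: "1 \<le> height v1 j" if "r < j" "j \<le> n" for j
    using r(3)[OF that] r0 by simp
  have "r \<le> p"
  proof (rule ccontr)
    assume "\<not> r \<le> p"
    then show False
      using r0 H[OF r(1)] by (simp add: H1)
  qed
  \<comment> \<open>The letter at \<open>p\<close> has become \<open>Ra\<close>, so a zero at
    \<open>p\<close> would persist at \<open>Suc p\<close>.\<close>
  moreover have "r \<noteq> p"
  proof
    assume "r = p"
    have "v1 ! p = Ra"
      using pn by (simp add: v1_def n_def)
    then show False
      using pos[of "Suc p"] r0 \<open>r = p\<close> pn by (simp add: height_Suc)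
  qed
  ultimately have rp: "r < p"
    by simp
  have "v1 ! r = Rc"
    using pos[of "Suc r"] r0 rp pn by (cases "v1 ! r") (auto simp: height_Suc)
  then have "v ! r = Rc"
    using rp by (simp add: v1_def)
  then have "bwd v r p"
    unfolding bwd_def using rp pn vp assms(1) p r0 pos unfolding v1_def n_def by auto
  then show ?thesis
    by blast
qed

text \<open>The first change raises the height by 2 beyond \<open>r\<close>, the second lowers it by
  1 beyond \<open>p\<close>; this gives the ballot condition and makes \<open>r\<close> the last
  zero in the intermediate word \<open>w1\<close>. The second change also lowers the surplus by 2
  beyond \<open>p\<close>, which turns the first maximum at \<open>Suc p\<close> into a last maximum
  at \<open>p\<close>.\<close>

lemma fwd_imp_bwd:
  assumes "fwd w r p"
  shows "bwd (w[r := Rc, p := Rb]) r p"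
proof -
  define n where "n = length w"
  define w1 where "w1 = w[r := Rc]"
  define v where "v = w1[p := Rb]"
  have f: "r < p" "p < n" "w ! r = Rb" "w ! p = Ra" "\<And>j. j \<le> n \<Longrightarrow> -1 \<le> height w j"
    "height w (Suc r) = -1" "\<And>j. j \<le> r \<Longrightarrow> 0 \<le> height w j"
    "\<And>j. j \<le> p \<Longrightarrow> surplus w1 j < surplus w1 (Suc p)"
    "\<And>j. j \<le> n \<Longrightarrow> surplus w1 j \<le> surplus w1 (Suc p)"
    using assms unfolding fwd_def w1_def n_def by auto
  have w1p: "w1 ! p = Ra" and lw1: "length w1 = n"
    using f by (simp_all add: w1_def n_def)
  have H1: "height w1 j = height w j + (if r < j then 2 else 0)" for j
    using f unfolding w1_def n_def height_def by (simp add: cnt_list_update)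
  have Hv: "height v j = height w1 j - (if p < j then 1 else 0)" for j
    using f w1p lw1 unfolding v_def height_def by (simp add: cnt_list_update)
  have Sv: "surplus v j = surplus w1 j - (if p < j then 2 else 0)" for j
    using f w1p lw1 unfolding v_def surplus_def by (simp add: cnt_list_update)
  have "v[p := Ra] = w1"
    using w1p unfolding v_def by (metis list_update_id list_update_overwrite)
  moreover have "height w1 r = 0"
    using f(6) f(3) by (simp add: H1 height_Suc)
  moreover have "1 \<le> height w1 j" if "r < j" "j \<le> n" for j
    using f(5)[of j] that by (simp add: H1)
  moreover have "ballot v"
    unfolding ballot_def
  proof (intro allI impI)
    fix j assume "j \<le> length v"
    then have "j \<le> n"
      using lw1 by (simp add: v_def)
    then show "0 \<le> height v j"
      using f(1) f(5)[of j] f(7)[of j] by (auto simp: Hv H1)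
  qed
  moreover have Sp: "surplus w1 (Suc p) = surplus v p + 1"
    using w1p by (simp add: Sv surplus_Suc)
  moreover have "surplus v j \<le> surplus v p" if "j \<le> n" for j
    using f(8)[of j] f(9)[OF that] Sp by (cases "p < j") (auto simp: Sv)
  moreover have "surplus v j < surplus v p" if "p < j" "j \<le> n" for j
    using f(9)[OF that(2)] Sp that by (auto simp: Sv)
  moreover have "v ! r = Rc" "v ! p = Rb" "length v = n"
    using f lw1 by (simp_all add: v_def w1_def n_def)
  ultimately have "bwd v r p"
    unfolding bwd_def using f(1,2) by auto
  then show ?thesis
    by (simp add: v_def w1_def)
qed

lemma bwd_imp_fwd:
  assumes "bwd v r p"
  shows "fwd (v[p := Ra, r := Rb]) r p" "good (v[p := Ra, r := Rb])"
proof -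
  define n where "n = length v"
  define w1 where "w1 = v[p := Ra]"
  define w where "w = w1[r := Rb]"
  have f: "r < p" "p < n" "v ! r = Rc" "v ! p = Rb" "\<And>j. j \<le> n \<Longrightarrow> 0 \<le> height v j"
    "\<And>j. j \<le> n \<Longrightarrow> surplus v j \<le> surplus v p"
    "\<And>j. p < j \<Longrightarrow> j \<le> n \<Longrightarrow> surplus v j < surplus v p"
    "height w1 r = 0" "\<And>j. r < j \<Longrightarrow> j \<le> n \<Longrightarrow> 1 \<le> height w1 j"
    using assms unfolding bwd_def ballot_def w1_def n_def by auto
  have w1r: "w1 ! r = Rc" and lw1: "length w1 = n"
    using f by (simp_all add: w1_def n_def)
  have H1: "height w1 j = height v j + (if p < j then 1 else 0)" for j
    using f unfolding w1_def n_def height_def by (simp add: cnt_list_update)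
  have S1: "surplus w1 j = surplus v j + (if p < j then 2 else 0)" for j
    using f unfolding w1_def n_def surplus_def by (simp add: cnt_list_update)
  have Hw: "height w j = height w1 j - (if r < j then 2 else 0)" for j
    using f w1r lw1 unfolding w_def height_def by (simp add: cnt_list_update)
  have Sw: "surplus w j = surplus w1 j - (if r < j then 1 else 0)" for j
    using f w1r lw1 unfolding w_def surplus_def by (simp add: cnt_list_update)
  have w_w1: "w[r := Rc] = w1"
    using w1r unfolding w_def by (metis list_update_id list_update_overwrite)
  have lw: "length w = n"
    by (simp add: w_def lw1)
  have wl: "w ! r = Rb" "w ! p = Ra"
    using f lw1 by (simp_all add: w_def w1_def n_def)
  have Hge: "-1 \<le> height w j" if "j \<le> n" for j
    using f(5)[OF that] f(9)[of j] that by (auto simp: Hw H1 split: if_splits)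
  have Hl: "height w (Suc r) = -1"
    using f(8) w1r height_Suc[of w1 r] by (simp add: Hw)
  have Hr: "0 \<le> height w j" if "j \<le> r" for j
    using f(5)[of j] that f(1,2) by (simp add: Hw H1)
  have Sp: "surplus w1 (Suc p) = surplus v p + 1"
    using f(4) surplus_Suc[of v p] by (simp add: S1)
  have Slt: "surplus w1 j < surplus w1 (Suc p)" if "j \<le> p" for j
    using f(6)[of j] that f(2) Sp by (simp add: S1)
  have Sle: "surplus w1 j \<le> surplus w1 (Suc p)" if "j \<le> n" for j
    using Slt[of j] f(7)[of j] that f(2) Sp by (cases "j \<le> p") (auto simp: S1)
  have "fwd w r p"
    unfolding fwd_def w_w1 lw using f(1,2) wl Hge Hl Hr Slt Sle by blast
  then show "fwd (v[p := Ra, r := Rb]) r p"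
    by (simp add: w_def w1_def)
  \<comment> \<open>Goodness is witnessed by \<open>l = Suc r\<close>, with \<open>q = Suc p\<close>
    serving every \<open>j\<close> at once.\<close>
  have "surplus w j \<le> surplus w (Suc p)" if "j \<le> Suc r" for j
    using Slt[of j] that f(1,2) by (auto simp: Sw)
  then have "good w"
    unfolding good_def lw using Hge Hl f(1,2)
    by (intro conjI exI[of _ "Suc r"]) (auto intro!: exI[of _ "Suc p"])
  then show "good (v[p := Ra, r := Rb])"
    by (simp add: w_def w1_def)
qed

section \<open>The exchange as a bijection\<close>

lemma fwd_unique:
  assumes "fwd w r p" "fwd w r' p'"
  shows "r = r' \<and> p = p'"
proof -
  have "\<not> r < r'" if "fwd w r p" "fwd w r' p'" for r p r' p'
  proof
    assume "r < r'"
    then have "0 \<le> height w (Suc r)"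
      using that(2) by (auto simp: fwd_def)
    then show False
      using that(1) by (simp add: fwd_def)
  qed
  then have r: "r = r'"
    using assms by (meson linorder_neqE_nat)
  have "\<not> p < p'" if "fwd w r p" "fwd w r p'" for p p'
  proof
    assume "p < p'"
    then have "surplus (w[r := Rc]) (Suc p) < surplus (w[r := Rc]) (Suc p')"
      using that(2) by (auto simp: fwd_def)
    moreover have "surplus (w[r := Rc]) (Suc p') \<le> surplus (w[r := Rc]) (Suc p)"
      using that by (auto simp: fwd_def)
    ultimately show False
      by simp
  qed
  then show ?thesis
    using assms r by (meson linorder_neqE_nat)
qed

lemma bwd_unique:
  assumes "bwd v r p" "bwd v r' p'"
  shows "r = r' \<and> p = p'"
proof -
  have "\<not> p < p'" if "bwd v r p" "bwd v r' p'" for r p r' p'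
  proof
    assume "p < p'"
    then have "surplus v p' < surplus v p"
      using that by (auto simp: bwd_def)
    moreover have "surplus v p \<le> surplus v p'"
      using that by (auto simp: bwd_def)
    ultimately show False
      by simp
  qed
  then have p: "p = p'"
    using assms by (meson linorder_neqE_nat)
  have "\<not> r < r'" if "bwd v r p" "bwd v r' p" for r r'
  proof
    assume "r < r'"
    then have "1 \<le> height (v[p := Ra]) r'"
      using that by (auto simp: bwd_def)
    then show False
      using that(2) by (simp add: bwd_def)
  qed
  then show ?thesis
    using assms p by (meson linorder_neqE_nat)
qed

text \<open>A relation rather than a function, so that the two positions need not be computed from
  the word; bi-uniqueness and totality on both sides then yield a bijection.\<close>

definition shift :: "row list \<Rightarrow> row list \<Rightarrow> bool" where
  "shift w v = (\<exists>r p. fwd w r p \<and> bwd v r p \<and> v = w[r := Rc, p := Rb] \<and> w = v[p := Ra, r := Rb])"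

lemma bi_unique_shift: "bi_unique shift"
proof -
  have "v = v'" if vv': "shift w v" "shift w v'" for w v v'
  proof -
    obtain r p where "fwd w r p" "v = w[r := Rc, p := Rb]"
      using vv'(1) by (auto simp: shift_def)
    moreover obtain r' p' where "fwd w r' p'" "v' = w[r' := Rc, p' := Rb]"
      using vv'(2) by (auto simp: shift_def)
    ultimately show ?thesis
      using fwd_unique[of w r p r' p'] by simp
  qed
  moreover have "w = w'" if ww': "shift w v" "shift w' v" for w w' v
  proof -
    obtain r p where "bwd v r p" "w = v[p := Ra, r := Rb]"
      using ww'(1) by (auto simp: shift_def)
    moreover obtain r' p' where "bwd v r' p'" "w' = v[p' := Ra, r' := Rb]"
      using ww'(2) by (auto simp: shift_def)
    ultimately show ?thesis
      using bwd_unique[of v r p r' p'] by simp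
  qed
  ultimately show ?thesis
    unfolding bi_unique_def by blast
qed

lemma fwd_imp_shift:
  assumes "fwd w r p"
  shows "shift w (w[r := Rc, p := Rb])"
proof -
  have "w = w[r := Rc, p := Rb, p := Ra, r := Rb]"
    using assms by (intro nth_equalityI) (auto simp: fwd_def nth_list_update)
  then show ?thesis
    unfolding shift_def using assms fwd_imp_bwd by blast
qed

lemma bwd_imp_shift:
  assumes "bwd v r p"
  shows "shift (v[p := Ra, r := Rb]) v"
proof -
  have "v = v[p := Ra, r := Rb, r := Rc, p := Rb]"
    using assms by (intro nth_equalityI) (auto simp: bwd_def nth_list_update)
  then show ?thesis
    unfolding shift_def using assms bwd_imp_fwd by blast
qed

lemma cnt_length: "cnt x w (length w) = int (count_list w x)"
proof (induction w rule: rev_induct)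
  case (snoc y w)
  have "cnt x (w @ [y]) (length w) = cnt x w (length w)"
    unfolding cnt_def by (intro sum.cong) (auto simp: nth_append)
  then show ?case
    using snoc by simp
qed simp

lemma shift_count:
  assumes "shift w v"
  shows "count_list w Ra = Suc (count_list v Ra)" "count_list w Rb = count_list v Rb"
    "Suc (count_list w Rc) = count_list v Rc" "ballot v" "good w"
proof -
  obtain r p where rp: "fwd w r p" "bwd v r p" "v = w[r := Rc, p := Rb]" "w = v[p := Ra, r := Rb]"
    using assms unfolding shift_def by blast
  have b: "r < p" "p < length w" "w ! r = Rb" "w ! p = Ra"
    using rp(1) by (auto simp: fwd_def)
  have "length v = length w"
    using rp(3) by simp
  then have *: "int (count_list v x) = cnt x w (length w) + (of_bool (Rc = x) - of_bool (Rb = x)) +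
      (of_bool (Rb = x) - of_bool (Ra = x))" for x
    unfolding cnt_length[symmetric] using b by (simp add: rp(3) cnt_list_update)
  show "count_list w Ra = Suc (count_list v Ra)" "count_list w Rb = count_list v Rb"
    "Suc (count_list w Rc) = count_list v Rc"
    using *[of Ra] *[of Rb] *[of Rc] by (simp_all add: cnt_length)
  show "ballot v"
    using rp(2) by (simp add: bwd_def)
  show "good w"
    using bwd_imp_fwd(2)[OF rp(2)] rp(4) by simp
qed

text \<open>The number \<open>i\<close> of leading letters \<open>a\<close> is carried along
  unchanged while \<open>w\<close> loses one \<open>a\<close> and gains one \<open>c\<close>. The
  assumptions imply \<open>m \<ge> 1\<close>, so \<open>m - 1\<close> is a genuine
  predecessor.\<close>

lemma card_good_eq_card_ballot:
  assumes "s \<ge> 1" "s \<le> M" "M \<le> m"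
  shows "card {(i, w). count_list w Ra + i = s \<and> count_list w Rb = M \<and> count_list w Rc = m - 1 \<and> good w} =
    card {(i, w). count_list w Ra + i = s - 1 \<and> count_list w Rb = M \<and> count_list w Rc = m \<and> ballot w}"
    (is "card ?X = card ?Y")
proof -
  let ?R = "rel_prod ((=) :: nat \<Rightarrow> nat \<Rightarrow> bool) shift"
  have "bi_unique ?R"
    by (intro prod.bi_unique_rel bi_unique_eq bi_unique_shift)
  moreover have "rel_set ?R ?X ?Y"
  proof (rule rel_setI)
    fix x assume x: "x \<in> ?X"
    obtain i w where iw: "x = (i, w)"
      by (cases x)
    obtain v where "shift w v"
      using x iw good_imp_fwd fwd_imp_shift by blast
    then show "\<exists>y\<in>?Y. ?R x y"
      using shift_count[of w v] x assms unfolding iw by (intro bexI[of _ "(i, v)"]) auto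
  next
    fix y assume y: "y \<in> ?Y"
    obtain i v where iv: "y = (i, v)"
      by (cases y)
    \<comment> \<open>At most \<open>s - 1 < M\<close> letters \<open>a\<close> face
      \<open>M\<close> letters \<open>b\<close>.\<close>
    have "surplus v (length v) < 0"
      using y iv assms by (auto simp: surplus_def cnt_length)
    then obtain w where "shift w v"
      using y iv ballot_imp_bwd bwd_imp_shift by blast
    then show "\<exists>x\<in>?X. ?R x y"
      using shift_count[of w v] y assms unfolding iv by (intro bexI[of _ "(i, w)"]) auto
  qed
  ultimately obtain f where "?Y = f ` ?X" "inj_on f ?X"
    by (rule bi_unique_rel_set_lemma)
  then show ?thesis
    by (simp add: card_image)
qed

section \<open>Ballot words and tableaux\<close>

text \<open>The indices of entries at most \<open>v\<close> form an initial segment. This turns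
  comparisons between the rows of a tableau into prefix counts.\<close>

lemma nth_le_iff_card:
  fixes xs :: "nat list"
  assumes "sorted_wrt (<) xs" "i < length xs"
  shows "xs ! i \<le> v \<longleftrightarrow> i < card {u \<in> set xs. u \<le> v}"
proof -
  let ?K = "{k. k < length xs \<and> xs ! k \<le> v}"
  have inj: "inj_on ((!) xs) ?K"
    using assms(1) by (intro inj_onI) (metis (lifting) linorder_neqE_nat mem_Collect_eq less_irrefl sorted_wrt_nth_less)
  have "{u \<in> set xs. u \<le> v} = (!) xs ` ?K"
    by (auto simp: set_conv_nth)
  then have card: "card {u \<in> set xs. u \<le> v} = card ?K"
    using inj by (simp add: card_image)
  show ?thesis
  proof (cases "xs ! i \<le> v")
    case True
    have "{..i} \<subseteq> ?K"
    proof
      fix k assume "k \<in> {..i}"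
      then have "xs ! k \<le> xs ! i"
        using assms by (metis atMost_iff le_neq_implies_less less_imp_le_nat order_refl sorted_wrt_nth_less)
      then show "k \<in> ?K"
        using True assms(2) \<open>k \<in> {..i}\<close> by auto
    qed
    then have "card {..i} \<le> card ?K"
      by (intro card_mono) auto
    then show ?thesis
      using True card by simp
  next
    case False
    have "?K \<subseteq> {..<i}"
    proof
      fix k assume k: "k \<in> ?K"
      show "k \<in> {..<i}"
      proof (rule ccontr)
        assume "k \<notin> {..<i}"
        then have "xs ! i \<le> xs ! k"
          using assms k
          by (metis lessThan_iff linorder_neqE_nat less_imp_le_nat mem_Collect_eq order_refl sorted_wrt_nth_less)
        then show False
          using k False by auto
      qed
    qed
    then have "card ?K \<le> card {..<i}"
      by (intro card_mono) auto
    then show ?thesis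
      using False card by simp
  qed
qed

text \<open>Counted from 1, since tableau entries start at 1.\<close>

definition positions :: "row list \<Rightarrow> row \<Rightarrow> nat set" where
  "positions w x = {u. 1 \<le> u \<and> u \<le> length w \<and> w ! (u - 1) = x}"

lemma finite_positions [simp]: "finite (positions w x)"
  by (rule finite_subset[of _ "{..length w}"]) (auto simp: positions_def)

lemma cnt_eq_card_positions:
  assumes "j \<le> length w"
  shows "cnt x w j = int (card {u \<in> positions w x. u \<le> j})"
  using assms
proof (induction j)
  case 0
  have "{u \<in> positions w x. u \<le> 0} = {}"
    by (auto simp: positions_def)
  then show ?case
    by simp
next
  case (Suc j)
  have "{u \<in> positions w x. u \<le> Suc j} =
    (if w ! j = x then insert (Suc j) {u \<in> positions w x. u \<le> j} else {u \<in> positions w x. u \<le> j})"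
    using Suc.prems by (auto simp: positions_def le_Suc_eq)
  then show ?case
    using Suc by simp
qed

lemma card_positions: "card (positions w x) = count_list w x"
proof -
  have "{u \<in> positions w x. u \<le> length w} = positions w x"
    by (auto simp: positions_def)
  then show ?thesis
    using cnt_eq_card_positions[of "length w" w x] by (simp add: cnt_length)
qed

definition bc_ballot :: "nat \<Rightarrow> nat \<Rightarrow> row list set" where
  "bc_ballot m M = {w. count_list w Ra = 0 \<and> count_list w Rb = M \<and> count_list w Rc = m \<and> ballot w}"

lemma length_eq_count_list: "length w = count_list w Ra + count_list w Rb + count_list w Rc"
proof (induction w)
  case (Cons x w)
  then show ?case
    by (cases x) auto
qed simp

text \<open>By the ballot condition, the prefix ending at the \<open>i\<close>-th \<open>b\<close>
  must contain the \<open>i\<close>-th \<open>c\<close>. Conversely, the column condition puts the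
  \<open>i\<close>-th \<open>c\<close> into every prefix that contains the \<open>i\<close>-th
  \<open>b\<close>.\<close>

lemma ballot_iff_sorted_positions:
  assumes w: "count_list w Rb \<le> count_list w Rc"
    and p: "sorted_wrt (<) p" "set p = positions w Rc" and q: "sorted_wrt (<) q" "set q = positions w Rb"
  shows "ballot w \<longleftrightarrow> (\<forall>i<count_list w Rb. p ! i < q ! i)"
proof -
  have len: "length p = count_list w Rc" "length q = count_list w Rb"
    using p q card_positions strict_sorted_iff distinct_card by metis+
  have np: "i < count_list w Rc \<Longrightarrow> p ! i \<le> v \<longleftrightarrow> i < card {u \<in> positions w Rc. u \<le> v}" for i v
    using nth_le_iff_card[OF p(1)] p(2) len by simp
  have nq: "i < count_list w Rb \<Longrightarrow> q ! i \<le> v \<longleftrightarrow> i < card {u \<in> positions w Rb. u \<le> v}" for i v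
    using nth_le_iff_card[OF q(1)] q(2) len by simp
  have b: "ballot w \<longleftrightarrow> (\<forall>j\<le>length w. card {u \<in> positions w Rb. u \<le> j} \<le> card {u \<in> positions w Rc. u \<le> j})"
    unfolding ballot_def height_def by (auto simp: cnt_eq_card_positions)
  show ?thesis
  proof
    assume bal: "ballot w"
    show "\<forall>i<count_list w Rb. p ! i < q ! i"
    proof (intro allI impI)
      fix i assume i: "i < count_list w Rb"
      have "q ! i \<in> positions w Rb"
        using i len q by (metis nth_mem)
      moreover have "p ! i \<in> positions w Rc"
        using i w len p by (metis nth_mem less_le_trans)
      ultimately have qi: "q ! i \<le> length w" "p ! i \<noteq> q ! i"
        by (auto simp: positions_def)
      have "i < card {u \<in> positions w Rb. u \<le> q ! i}"
        using nq[OF i, of "q ! i"] by simp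
      also have "\<dots> \<le> card {u \<in> positions w Rc. u \<le> q ! i}"
        using bal b qi by blast
      finally have "p ! i \<le> q ! i"
        using np i w by simp
      then show "p ! i < q ! i"
        using qi by simp
    qed
  next
    assume lt: "\<forall>i<count_list w Rb. p ! i < q ! i"
    have "card {u \<in> positions w Rb. u \<le> j} \<le> card {u \<in> positions w Rc. u \<le> j}" for j
    proof (cases "card {u \<in> positions w Rb. u \<le> j}")
      \<comment> \<open>\<open>i\<close> is the index of the last \<open>b\<close> in the
        prefix.\<close>
      case (Suc i)
      have "card {u \<in> positions w Rb. u \<le> j} \<le> card (positions w Rb)"
        by (intro card_mono) auto
      then have i: "i < count_list w Rb"
        using Suc by (simp add: card_positions)
      then have "q ! i \<le> j"
        using nq[OF i] Suc by simp
      then have "p ! i \<le> j"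
        using lt i by (meson less_imp_le order_trans)
      then show ?thesis
        using np[of i j] i w Suc by simp
    qed (simp only: le0)
    then show "ballot w"
      using b by blast
  qed
qed

lemma positions_Un: "positions w Ra \<union> positions w Rb \<union> positions w Rc = {1..length w}"
proof -
  have "w ! k = Ra \<or> w ! k = Rb \<or> w ! k = Rc" for k
    by (cases "w ! k") auto
  then show ?thesis
    by (auto simp: positions_def)
qed

lemma positions_inject:
  assumes "length w = length w'" "\<And>x. positions w x = positions w' x"
  shows "w = w'"
proof (rule nth_equalityI)
  fix k assume k: "k < length w"
  then have "Suc k \<in> positions w (w ! k)"
    by (simp add: positions_def)
  then have "Suc k \<in> positions w' (w ! k)"
    using assms(2) by simp
  then show "w ! k = w' ! k"
    by (simp add: positions_def)
qed (use assms in simp)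

lemma sorted_list_of_set_eqI:
  assumes "sorted_wrt (<) (xs :: nat list)" "set xs = X"
  shows "sorted_list_of_set X = xs"
  using assms by (metis sorted_list_of_set.idem_if_sorted_distinct strict_sorted_iff)

text \<open>The letters \<open>c\<close> mark the entries of the first row of the tableau, the
  letters \<open>b\<close> those of the second.\<close>

lemma card_bc_ballot:
  assumes "M \<le> m"
  shows "card (bc_ballot m M) = num_syt2 m M"
proof -
  let ?g = "\<lambda>w. (sorted_list_of_set (positions w Rc), sorted_list_of_set (positions w Rb))"
  have noA: "positions w Ra = {}" "length w = m + M" if "w \<in> bc_ballot m M" for w
    using that length_eq_count_list[of w] card_positions[of w Ra] by (auto simp: bc_ballot_def)
  have "inj_on ?g (bc_ballot m M)"
  proof (rule inj_onI)
    fix w w' assume ww': "w \<in> bc_ballot m M" "w' \<in> bc_ballot m M" "?g w = ?g w'"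
    have "positions w x = positions w' x" for x
      using ww' noA by (cases x) (auto dest: sorted_list_of_set_inject)
    then show "w = w'"
      using positions_inject noA ww' by simp
  qed
  moreover have "?g ` bc_ballot m M = {T. is_syt2 m M T}"
  proof
    show "?g ` bc_ballot m M \<subseteq> {T. is_syt2 m M T}"
    proof
      fix T assume "T \<in> ?g ` bc_ballot m M"
      then obtain w where w: "w \<in> bc_ballot m M" "T = ?g w"
        by auto
      have c: "count_list w Rb = M" "count_list w Rc = m" "ballot w"
        using w(1) by (auto simp: bc_ballot_def)
      have "positions w Rc \<inter> positions w Rb = {}"
        by (auto simp: positions_def)
      moreover have "positions w Rc \<union> positions w Rb = {1..m + M}"
        using positions_Un[of w] noA[OF w(1)] by auto
      moreover have "\<forall>i<M. sorted_list_of_set (positions w Rc) ! i < sorted_list_of_set (positions w Rb) ! i"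
        using ballot_iff_sorted_positions[of w "sorted_list_of_set (positions w Rc)"
            "sorted_list_of_set (positions w Rb)"] c assms by simp
      ultimately show "T \<in> {T. is_syt2 m M T}"
        using c unfolding w(2) by (simp add: is_syt2_def card_positions)
    qed
  next
    show "{T. is_syt2 m M T} \<subseteq> ?g ` bc_ballot m M"
    proof
      fix T assume "T \<in> {T. is_syt2 m M T}"
      then obtain p q where T: "T = (p, q)" "is_syt2 m M (p, q)"
        by (cases T) auto
      then have pq: "length p = m" "length q = M" "sorted_wrt (<) p" "sorted_wrt (<) q"
        "\<forall>i<M. p ! i < q ! i" "distinct p" "distinct q" "set p \<inter> set q = {}" "set p \<union> set q = {1..m + M}"
        by (auto simp: is_syt2_def)
      define w where "w = map (\<lambda>v. if v \<in> set p then Rc else Rb) [1..<m + M + 1]"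
      have lw: "length w = m + M"
        by (simp add: w_def del: upt_Suc)
      have nth: "w ! (u - 1) = (if u \<in> set p then Rc else Rb)" if "1 \<le> u" "u \<le> m + M" for u
        using that by (auto simp: w_def simp del: upt_Suc)
      have pos: "positions w Rc = set p" "positions w Rb = set q" "positions w Ra = {}"
      proof -
        have "u \<in> positions w x \<longleftrightarrow> u \<in> set p \<union> set q \<and> (if u \<in> set p then Rc else Rb) = x" for u x
          unfolding positions_def lw pq(9) mem_Collect_eq atLeastAtMost_iff using nth[of u] by metis
        then show "positions w Rc = set p" "positions w Rb = set q" "positions w Ra = {}"
          using pq(8) by (auto split: if_splits)
      qed
      have cl: "count_list w Rc = m" "count_list w Rb = M" "count_list w Ra = 0"
        using pos pq by (simp_all add: card_positions[symmetric] distinct_card)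
      then have "ballot w"
        using ballot_iff_sorted_positions[of w p q] pos pq assms by simp
      then have "w \<in> bc_ballot m M"
        using cl by (simp add: bc_ballot_def)
      moreover have "T = ?g w"
        using pos pq by (simp add: T sorted_list_of_set_eqI)
      ultimately show "T \<in> ?g ` bc_ballot m M"
        by blast
    qed
  qed
  ultimately have "bij_betw ?g (bc_ballot m M) {T. is_syt2 m M T}"
    by (simp add: bij_betw_def)
  then show ?thesis
    by (simp add: num_syt2_def bij_betw_same_card)
qed

section \<open>Ballot words with letters \<open>a\<close> inserted\<close>

lemma cnt_Cons_Suc: "cnt x (y # w) (Suc j) = of_bool (y = x) + cnt x w j"
  unfolding cnt_def by (subst sum.lessThan_Suc_shift) simp

text \<open>The offset \<open>h\<close> lets the ballot condition pass to the tail of a word, as the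
  induction in \<open>ballot_filter\<close> requires.\<close>

lemma all_height_Cons:
  "(\<forall>j\<le>length (x # w). 0 \<le> h + height (x # w) j) \<longleftrightarrow>
    0 \<le> h \<and> (\<forall>j\<le>length w. 0 \<le> h + (of_bool (x = Rc) - of_bool (x = Rb)) + height w j)"
proof -
  have *: "height (x # w) (Suc j) = of_bool (x = Rc) - of_bool (x = Rb) + height w j" for j
    by (simp add: height_def cnt_Cons_Suc del: cnt_Suc)
  have "(\<forall>j\<le>length (x # w). P j) \<longleftrightarrow> P 0 \<and> (\<forall>j\<le>length w. P (Suc j))" for P
    using All_less_Suc2[of "Suc (length w)" P] by (simp add: less_Suc_eq_le)
  then show ?thesis
    by (simp add: * add.assoc)
qed

lemma ballot_filter: "ballot (filter (\<lambda>x. x \<noteq> Ra) w) = ballot w"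
proof -
  have "(\<forall>j\<le>length (filter (\<lambda>x. x \<noteq> Ra) w). 0 \<le> h + height (filter (\<lambda>x. x \<noteq> Ra) w) j) \<longleftrightarrow>
    (\<forall>j\<le>length w. 0 \<le> h + height w j)" for h
  proof (induction w arbitrary: h)
    case (Cons x w)
    show ?case
    proof (cases "x = Ra")
      case True
      have "(\<forall>j\<le>length w. 0 \<le> h + height w j) \<Longrightarrow> 0 \<le> h"
        by (metis add.right_neutral height_0 le0)
      then show ?thesis
        using True Cons.IH[of h] all_height_Cons[of x w h] by auto
    next
      case False
      then have "filter (\<lambda>x. x \<noteq> Ra) (x # w) = x # filter (\<lambda>x. x \<noteq> Ra) w"
        by simp
      then show ?thesis
        by (simp only: all_height_Cons Cons.IH)
    qed
  qed simp
  from this[of 0] show ?thesis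
    by (simp add: ballot_def)
qed

text \<open>Presents the words with a prescribed \<open>a\<close>-free part as shuffles, so that the
  count of disjoint shuffles gives the binomial coefficient.\<close>

lemma in_shuffles_replicate_iff:
  assumes "Ra \<notin> set y"
  shows "x \<in> shuffles (replicate k Ra) y \<longleftrightarrow> filter (\<lambda>r. r \<noteq> Ra) x = y \<and> count_list x Ra = k"
proof
  assume x: "x \<in> shuffles (replicate k Ra) y"
  have "filter (\<lambda>r. r \<noteq> Ra) y = y"
    using assms by (metis (mono_tags, lifting) filter_True)
  then have "filter (\<lambda>r. r \<noteq> Ra) ` shuffles (replicate k Ra) y = {y}"
    by (simp add: filter_shuffles)
  moreover have "filter (\<lambda>r. r = Ra) y = []"
    using assms by (auto simp: filter_empty_conv)
  then have "filter (\<lambda>r. r = Ra) ` shuffles (replicate k Ra) y = {replicate k Ra}"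
    by (simp add: filter_shuffles)
  ultimately have "filter (\<lambda>r. r \<noteq> Ra) x = y" "filter (\<lambda>r. r = Ra) x = replicate k Ra"
    using x by blast+
  then show "filter (\<lambda>r. r \<noteq> Ra) x = y \<and> count_list x Ra = k"
    by (metis (mono_tags, lifting) count_list_eq_length_filter filter_cong length_replicate)
next
  assume x: "filter (\<lambda>r. r \<noteq> Ra) x = y \<and> count_list x Ra = k"
  have "filter (\<lambda>r. r = Ra) x = replicate k Ra"
    using x by (metis (mono_tags, lifting) count_list_eq_length_filter filter_cong mem_Collect_eq
        replicate_length_same set_filter)
  then show "x \<in> shuffles (replicate k Ra) y"
    using x partition_in_shuffles[of x "\<lambda>r. r = Ra"] by simp
qed

lemma count_list_filter_other: "x \<noteq> Ra \<Longrightarrow> count_list (filter (\<lambda>r. r \<noteq> Ra) w) x = count_list w x"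
  by (induction w) auto

lemma count_list_filter_Ra: "count_list (filter (\<lambda>r. r \<noteq> Ra) w) Ra = 0"
  by (simp add: count_list_0_iff)

lemma filter_in_bc_ballot:
  "filter (\<lambda>r. r \<noteq> Ra) w \<in> bc_ballot m M \<longleftrightarrow> count_list w Rb = M \<and> count_list w Rc = m \<and> ballot w"
  by (simp add: bc_ballot_def count_list_filter_other count_list_filter_Ra ballot_filter)

text \<open>The pair \<open>(i, w)\<close> is encoded as the word \<open>a^i c w\<close>; its first
  letter other than \<open>a\<close> is the inserted \<open>c\<close>, so \<open>i\<close> can be
  read off. The image consists of all shuffles of \<open>k\<close> letters \<open>a\<close> with
  \<open>c z\<close>, for \<open>z\<close> an \<open>a\<close>-free ballot word. The inserted
  \<open>c\<close> accounts for the \<open>+ 1\<close> in the binomial coefficient.\<close>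

lemma card_ballot:
  assumes "M \<le> m"
  shows "card {(i, w). count_list w Ra + i = k \<and> count_list w Rb = M \<and> count_list w Rc = m \<and> ballot w} =
    ((k + m + M + 1) choose k) * num_syt2 m M" (is "card ?Y = _")
proof -
  let ?f = "\<lambda>(i, w). replicate i Ra @ Rc # w"
  let ?Z = "\<Union>z\<in>bc_ballot m M. shuffles (replicate k Ra) (Rc # z)"
  have zA: "Ra \<notin> set (Rc # z)" if "z \<in> bc_ballot m M" for z
    using that by (auto simp: bc_ballot_def count_list_0_iff)
  have inj: "inj_on ?f ?Y"
  proof (rule inj_onI)
    fix u u' assume "?f u = ?f u'"
    obtain i w i' w' where uu': "u = (i, w)" "u' = (i', w')"
      by (cases u, cases u')
    have eq: "replicate i Ra @ Rc # w = replicate i' Ra @ Rc # w'"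
      using \<open>?f u = ?f u'\<close> by (simp add: uu')
    have "takeWhile (\<lambda>r. r = Ra) (replicate j Ra @ Rc # v) = replicate j Ra" for j v
      by (simp add: takeWhile_append)
    then have "replicate i Ra = replicate i' Ra"
      using eq by metis
    then show "u = u'"
      using eq uu' by (metis append_same_eq length_replicate list.inject same_append_eq)
  qed
  have img: "?f ` ?Y = ?Z"
  proof
    show "?f ` ?Y \<subseteq> ?Z"
    proof
      fix x assume "x \<in> ?f ` ?Y"
      then obtain i w where w: "x = replicate i Ra @ Rc # w" "count_list w Ra + i = k"
        "count_list w Rb = M" "count_list w Rc = m" "ballot w"
        by auto
      define z where "z = filter (\<lambda>r. r \<noteq> Ra) w"
      have z: "z \<in> bc_ballot m M"
        unfolding z_def filter_in_bc_ballot using w by simp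
      have "count_list (replicate i Ra) Ra = i"
        by (induction i) auto
      then have "x \<in> shuffles (replicate k Ra) (Rc # z)"
        unfolding in_shuffles_replicate_iff[OF zA[OF z]] using w by (simp add: z_def)
      then show "x \<in> ?Z"
        using z by blast
    qed
  next
    show "?Z \<subseteq> ?f ` ?Y"
    proof
      fix x assume "x \<in> ?Z"
      then obtain z where z: "z \<in> bc_ballot m M" "x \<in> shuffles (replicate k Ra) (Rc # z)"
        by auto
      then have x: "filter (\<lambda>r. r \<noteq> Ra) x = Rc # z" "count_list x Ra = k"
        using in_shuffles_replicate_iff[OF zA[OF z(1)]] by auto
      obtain us w where us: "x = us @ Rc # w" "\<forall>u\<in>set us. u = Ra" "z = filter (\<lambda>r. r \<noteq> Ra) w"
        using x(1) unfolding filter_eq_Cons_iff by auto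
      define i where "i = length us"
      have us': "us = replicate i Ra"
        using us(2) unfolding i_def by (metis replicate_length_same)
      have "count_list (replicate i Ra) Ra = i"
        by (induction i) auto
      then have "(i, w) \<in> ?Y"
        using z(1) x(2) us(1) unfolding us(3) us' filter_in_bc_ballot by simp
      moreover have "x = ?f (i, w)"
        using us us' by simp
      ultimately show "x \<in> ?f ` ?Y"
        by blast
    qed
  qed
  have "card ?Y = card ?Z"
    using card_image[OF inj] unfolding img by (rule sym)
  also have "\<dots> = (\<Sum>z\<in>bc_ballot m M. card (shuffles (replicate k Ra) (Rc # z)))"
  proof (rule card_UN_disjoint)
    have "finite {xs. set xs \<subseteq> {Ra, Rb, Rc} \<and> length xs = m + M}"
      by (rule finite_lists_length_eq) simp
    moreover have "x \<in> {Ra, Rb, Rc}" for x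
      by (cases x) auto
    then have "bc_ballot m M \<subseteq> {xs. set xs \<subseteq> {Ra, Rb, Rc} \<and> length xs = m + M}"
      unfolding bc_ballot_def length_eq_count_list by auto
    ultimately show "finite (bc_ballot m M)"
      by (rule finite_subset[rotated])
    show "\<forall>z\<in>bc_ballot m M. \<forall>z'\<in>bc_ballot m M. z \<noteq> z' \<longrightarrow>
      shuffles (replicate k Ra) (Rc # z) \<inter> shuffles (replicate k Ra) (Rc # z') = {}"
      using zA by (auto simp: in_shuffles_replicate_iff)
  qed auto
  also have "\<dots> = (\<Sum>z\<in>bc_ballot m M. (k + m + M + 1) choose k)"
  proof (rule sum.cong)
    fix z assume z: "z \<in> bc_ballot m M"
    then have "length z = m + M"
      using length_eq_count_list[of z] by (auto simp: bc_ballot_def)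
    moreover have "set (replicate k Ra) \<inter> set (Rc # z) = {}"
      using zA[OF z] by auto
    ultimately show "card (shuffles (replicate k Ra) (Rc # z)) = (k + m + M + 1) choose k"
      using card_disjoint_shuffles[of "replicate k Ra" "Rc # z"] by (simp add: add.assoc)
  qed simp
  also have "\<dots> = ((k + m + M + 1) choose k) * num_syt2 m M"
    by (simp add: card_bc_ballot[OF assms])
  finally show ?thesis .
qed

section \<open>Labels read off the backward word\<close>

text \<open>Counted from 0, unlike \<open>positions\<close>: index 0 is where the backward reading
  starts.\<close>

definition index_set :: "row list \<Rightarrow> row \<Rightarrow> nat set" where
  "index_set w x = {j. j < length w \<and> w ! j = x}"

text \<open>\<^const>\<open>unmatched\<close> in backward coordinates, where an arc ends at its smallest index.\<close>

definition back_unmatched :: "nat \<Rightarrow> nat set \<Rightarrow> nat set \<Rightarrow> nat \<Rightarrow> bool" where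
  "back_unmatched N A B k = (\<forall>k'<N. card (A \<inter> arc k k') < card (B \<inter> arc k k'))"

text \<open>Index 0 stands for c_2, which is to have label 3, and \<open>k\<close> for c_1, which is
  to have label 1; the two conditions are those of \<open>label_iff\<close>. The inner set consists
  of the row-2 entries on paths from row 1.\<close>

definition label_13 :: "row list \<Rightarrow> nat \<Rightarrow> bool" where
  "label_13 J k = (back_unmatched (length J) (index_set J Rb) (index_set J Rc) 0 \<and>
     \<not> back_unmatched (length J)
       {j \<in> index_set J Rb. \<not> back_unmatched (length J) (index_set J Ra) (index_set J Rb) j}
       (index_set J Rc) k)"

lemma finite_index_set [simp]: "finite (index_set w x)"
  by (simp add: index_set_def)

lemma card_index_interval:
  assumes "k \<le> k'"
  shows "int (card {j. k \<le> j \<and> j < k' \<and> w ! j = x}) = cnt x w k' - cnt x w k"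
  using assms
proof (induction k' rule: dec_induct)
  case base
  have "{j. k \<le> j \<and> j < k \<and> w ! j = x} = {}"
    by auto
  then show ?case
    by (metis (no_types, lifting) card.empty diff_self of_nat_0)
next
  case (step m)
  have eq: "{j. k \<le> j \<and> j < Suc m \<and> w ! j = x} =
      (if w ! m = x then insert m {j. k \<le> j \<and> j < m \<and> w ! j = x} else {j. k \<le> j \<and> j < m \<and> w ! j = x})"
    using step(1) by (auto simp: less_Suc_eq)
  have "finite {j. k \<le> j \<and> j < m \<and> w ! j = x}"
    by (rule finite_subset[of _ "{..<m}"]) auto
  then show ?case
    using step(3) unfolding eq by (simp add: of_bool_def)
qed

lemma card_index_arc:
  assumes "k < length J" "k' < length J"
  shows "int (card (index_set J x \<inter> arc k k')) =
    (if k \<le> k' then cnt x J (Suc k') - cnt x J k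
     else cnt x J (length J) - cnt x J k + cnt x J (Suc k'))"
proof (cases "k \<le> k'")
  case True
  then have "index_set J x \<inter> arc k k' = {j. k \<le> j \<and> j < Suc k' \<and> J ! j = x}"
    using assms by (auto simp: index_set_def arc_def)
  then show ?thesis
    using True card_index_interval[of k "Suc k'" J x] by simp
next
  case False
  let ?X = "{j. k \<le> j \<and> j < length J \<and> J ! j = x}" and ?Y = "{j. 0 \<le> j \<and> j < Suc k' \<and> J ! j = x}"
  have "index_set J x \<inter> arc k k' = ?X \<union> ?Y"
    using False assms by (auto simp: index_set_def arc_def)
  moreover have "?X \<inter> ?Y = {}"
    using False by auto
  moreover have "finite ?X" "finite ?Y"
    by (rule finite_subset[of _ "{..<length J}"], use assms in auto)+
  ultimately have "card (index_set J x \<inter> arc k k') = card ?X + card ?Y"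
    by (simp add: card_Un_disjoint)
  then show ?thesis
    using False assms card_index_interval[of k "length J" J x] card_index_interval[of 0 "Suc k'" J x]
    by simp
qed

lemma cnt_append_left:
  assumes "j \<le> length u"
  shows "cnt x (u @ v) j = cnt x u j"
  using assms unfolding cnt_def by (intro sum.cong) (auto simp: nth_append)

lemma cnt_append_right: "cnt x (u @ v) (length u + j) = cnt x u (length u) + cnt x v j"
  by (induction j) (simp_all add: cnt_append_left nth_append)

lemma cnt_replicate: "j \<le> i \<Longrightarrow> cnt x (replicate i y) j = of_bool (y = x) * int j"
  by (induction j) auto

section \<open>Words \<open>c a^i c w\<close>, with c_2 at index 0, c_1 at index
  \<open>Suc i\<close>, and \<open>w\<close> after it\<close>

context
  fixes i :: nat and w J :: "row list"
  assumes J: "J = Rc # replicate i Ra @ Rc # w"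
begin

lemma cnt_J_prefix: "j \<le> i \<Longrightarrow> cnt x J (Suc j) = of_bool (Rc = x) + of_bool (Ra = x) * int j"
  unfolding J cnt_Cons_Suc by (simp add: cnt_append_left cnt_replicate)

lemma cnt_J_suffix: "cnt x J (Suc (Suc (i + j))) = 2 * of_bool (Rc = x) + of_bool (Ra = x) * int i + cnt x w j"
proof -
  have "cnt x (replicate i Ra @ Rc # w) (i + Suc j) = of_bool (Ra = x) * int i + (of_bool (Rc = x) + cnt x w j)"
    using cnt_append_right[of x "replicate i Ra" "Rc # w" "Suc j"]
    by (simp add: cnt_replicate cnt_Cons_Suc del: cnt_Suc)
  then show ?thesis
    unfolding J cnt_Cons_Suc by simp
qed

lemma surplus_J_suffix: "surplus J (Suc (Suc (i + j))) = int i + surplus w j"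
  by (simp add: surplus_def cnt_J_suffix del: cnt_Suc)

lemma height_J_suffix: "height J (Suc (Suc (i + j))) = 2 + height w j"
  by (simp add: height_def cnt_J_suffix del: cnt_Suc)

lemma surplus_J_prefix: "j \<le> i \<Longrightarrow> surplus J (Suc j) = int j"
  by (simp add: surplus_def cnt_J_prefix del: cnt_Suc)

lemma height_J_prefix: "j \<le> i \<Longrightarrow> height J (Suc j) = 1"
  by (simp add: height_def cnt_J_prefix del: cnt_Suc)

lemma length_J: "length J = Suc (Suc (i + length w))"
  by (simp add: J)

lemma J_index_cases:
  assumes "k < length J"
  shows "k \<le> i \<or> (\<exists>j\<le>length w. k = Suc (i + j))"
proof (cases "k \<le> i")
  case False
  then have "k = Suc (i + (k - Suc i))" "k - Suc i \<le> length w"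
    using assms length_J by auto
  then show ?thesis
    by blast
qed simp

lemma nth_J_suffix: "J ! Suc (Suc (i + j)) = w ! j"
proof -
  have "J ! Suc (Suc (i + j)) = (replicate i Ra @ Rc # w) ! (length (replicate i Ra) + Suc j)"
    by (simp add: J)
  also have "\<dots> = w ! j"
    by (subst nth_append_length_plus) simp
  finally show ?thesis .
qed

text \<open>On the initial stretch \<open>c a^i\<close> the height is 1, so the condition holds
  there; from the second \<open>c\<close> on it is the height of \<open>w\<close> raised by
  2.\<close>

lemma back_unmatched_0_iff:
  "back_unmatched (length J) (index_set J Rb) (index_set J Rc) 0 \<longleftrightarrow> (\<forall>j\<le>length w. -1 \<le> height w j)"
proof -
  have "card (index_set J Rb \<inter> arc 0 k') < card (index_set J Rc \<inter> arc 0 k') \<longleftrightarrow> 1 \<le> height J (Suc k')"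
    if "k' < length J" for k'
  proof -
    have "int (card (index_set J x \<inter> arc 0 k')) = cnt x J (Suc k')" for x
      using card_index_arc[of 0 J k' x] that length_J by (simp del: cnt_Suc)
    then show ?thesis
      unfolding height_def by (smt (verit) of_nat_less_iff)
  qed
  then have "back_unmatched (length J) (index_set J Rb) (index_set J Rc) 0 \<longleftrightarrow>
      (\<forall>k'<length J. 1 \<le> height J (Suc k'))"
    unfolding back_unmatched_def by blast
  also have "\<dots> \<longleftrightarrow> (\<forall>j\<le>length w. -1 \<le> height w j)"
  proof
    assume *: "\<forall>k'<length J. 1 \<le> height J (Suc k')"
    show "\<forall>j\<le>length w. -1 \<le> height w j"
    proof (intro allI impI)
      fix j assume "j \<le> length w"
      then have "1 \<le> height J (Suc (Suc (i + j)))"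
        using * length_J by auto
      then show "-1 \<le> height w j"
        by (simp add: height_J_suffix)
    qed
  next
    assume *: "\<forall>j\<le>length w. -1 \<le> height w j"
    show "\<forall>k'<length J. 1 \<le> height J (Suc k')"
    proof (intro allI impI)
      fix k assume "k < length J"
      then consider "k \<le> i" | j where "j \<le> length w" "k = Suc (i + j)"
        using J_index_cases by blast
      then show "1 \<le> height J (Suc k)"
      proof cases
        case 1
        then show ?thesis
          by (simp add: height_J_prefix)
      next
        case 2
        then show ?thesis
          using * by (auto simp: height_J_suffix)
      qed
    qed
  qed
  finally show ?thesis .
qed

text \<open>A row-2 entry at the last maximum of \<^const>\<open>surplus\<close> could only be bullied by a wrapping
  path, and there are too few row-1 entries for that.\<close>

lemma not_matched_at_last_argmax:
  assumes neg: "surplus J (length J) < 0" and j: "j < length w" "w ! j = Rb"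
    and max: "\<And>q. q \<le> length w \<Longrightarrow> surplus w q \<le> surplus w j"
      "\<And>q. j < q \<Longrightarrow> q \<le> length w \<Longrightarrow> surplus w q < surplus w j"
  shows "back_unmatched (length J) (index_set J Ra) (index_set J Rb) (Suc (Suc (i + j)))"
  unfolding back_unmatched_def
proof (intro allI impI)
  fix k assume k: "k < length J"
  let ?c = "\<lambda>x. card (index_set J x \<inter> arc (Suc (Suc (i + j))) k)"
  have jJ: "Suc (Suc (i + j)) < length J"
    using j length_J by simp
  have "int (?c Ra) - int (?c Rb) < 0"
  proof (cases "Suc (Suc (i + j)) \<le> k")
    case True
    then obtain q where q: "q \<le> length w" "k = Suc (i + q)"
      using J_index_cases[OF k] by auto
    have "int (?c Ra) - int (?c Rb) = surplus J (Suc k) - surplus J (Suc (Suc (i + j)))"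
      unfolding card_index_arc[OF jJ k] using True by (simp add: surplus_def del: cnt_Suc)
    also have "\<dots> < 0"
      using max(2)[of q] q True unfolding q(2) surplus_J_suffix by simp
    finally show ?thesis .
  next
    case False
    \<comment> \<open>On a wrapping arc, the excess of \<open>a\<close> over \<open>b\<close> is the
      total surplus, which is negative, plus a difference that is at most 0 by maximality.\<close>
    have "surplus J (Suc k) \<le> surplus J (Suc (Suc (i + j)))"
    proof -
      consider "k \<le> i" | q where "q \<le> length w" "k = Suc (i + q)"
        using J_index_cases k by blast
      then show ?thesis
      proof cases
        case 1
        then show ?thesis
          using max(1)[of 0] by (simp only: surplus_J_prefix surplus_J_suffix) simp
      next
        case 2
        then show ?thesis
          using max(1)[of q] by (simp only: surplus_J_suffix) simp
      qed
    qed
    moreover have "int (?c Ra) - int (?c Rb) =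
        surplus J (length J) - surplus J (Suc (Suc (i + j))) + surplus J (Suc k)"
      unfolding card_index_arc[OF jJ k] using False by (simp add: surplus_def del: cnt_Suc)
    ultimately show ?thesis
      using neg by linarith
  qed
  then show "?c Ra < ?c Rb"
    by simp
qed

text \<open>\<open>M1\<close> collects the row-2 entries on paths from row 1. On the arc from c_1 to
  the end of the prefix of length \<open>l\<close> of \<open>w\<close>, the number of
  \<open>b\<close> minus that of \<open>c\<close> is \<open>-1 - height w l\<close>, which is at
  most 0 when c_2 has label 3. Hence c_1 then has label 1 iff equality holds for some
  \<open>l\<close> and every \<open>b\<close> on that arc lies in \<open>M1\<close>.\<close>

lemma label_13_iff_good:
  assumes "count_list J Ra < count_list J Rb"
  shows "label_13 J (Suc i) \<longleftrightarrow> good w"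
proof -
  have neg: "surplus J (length J) < 0"
    using assms by (simp add: surplus_def cnt_length)
  define M1 where "M1 = {j \<in> index_set J Rb. \<not> back_unmatched (length J) (index_set J Ra) (index_set J Rb) j}"
  have M1b: "M1 \<subseteq> index_set J Rb"
    by (auto simp: M1_def)
  have iJ: "Suc i < length J"
    by (simp add: length_J)
  have cnt_i: "cnt x J (Suc i) = of_bool (Rc = x) + of_bool (Ra = x) * int i" for x
    by (rule cnt_J_prefix) simp
  have arcB: "int (card (index_set J Rb \<inter> arc (Suc i) (Suc (i + l)))) = cnt Rb w l"
    and arcC: "int (card (index_set J Rc \<inter> arc (Suc i) (Suc (i + l)))) = cnt Rc w l + 1"
    if "l \<le> length w" for l
    using that by (subst card_index_arc; simp add: length_J cnt_J_suffix cnt_i del: cnt_Suc)+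
  show ?thesis
  proof
    assume lab: "label_13 J (Suc i)"
    then have H: "\<forall>j\<le>length w. -1 \<le> height w j"
      using back_unmatched_0_iff by (simp add: label_13_def)
    obtain k where k: "k < length J"
      "card (index_set J Rc \<inter> arc (Suc i) k) \<le> card (M1 \<inter> arc (Suc i) k)"
      using lab unfolding label_13_def M1_def[symmetric] by (auto simp: back_unmatched_def not_less)
    have M1le: "card (M1 \<inter> arc (Suc i) k) \<le> card (index_set J Rb \<inter> arc (Suc i) k)"
      using M1b by (intro card_mono) auto
    \<comment> \<open>Such an arc wraps past c_2, and it still contains more \<open>c\<close> than
      \<open>b\<close>.\<close>
    have "\<not> k \<le> i"
    proof
      assume ki: "k \<le> i"
      have "int (card (index_set J x \<inter> arc (Suc i) k)) = cnt x J (length J) - cnt x J (Suc i) + cnt x J (Suc k)" for x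
        using card_index_arc[OF iJ k(1)] ki by simp
      then have "height J (length J) - height J (Suc i) + height J (Suc k) \<le> 0"
        using k(2) M1le unfolding height_def by (smt (verit) of_nat_le_iff)
      moreover have "1 \<le> height J (length J)"
        using H unfolding length_J height_J_suffix by auto
      ultimately show False
        using ki by (simp add: height_J_prefix)
    qed
    then obtain l where l: "l \<le> length w" "k = Suc (i + l)"
      using J_index_cases[OF k(1)] by auto
    have "cnt Rc w l + 1 \<le> cnt Rb w l"
      using k(2) M1le arcB[OF l(1)] arcC[OF l(1)] unfolding l(2) by linarith
    moreover have "-1 \<le> height w l"
      using H l by blast
    ultimately have Hl: "height w l = -1"
      by (simp add: height_def)
    have "card (index_set J Rb \<inter> arc (Suc i) k) \<le> card (M1 \<inter> arc (Suc i) k)"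
      using k(2) arcB[OF l(1)] arcC[OF l(1)] Hl unfolding l(2) height_def by linarith
    then have all: "M1 \<inter> arc (Suc i) k = index_set J Rb \<inter> arc (Suc i) k"
      using M1b by (intro card_seteq) auto
    \<comment> \<open>If this fails at some \<open>j\<close>, the last maximum of the surplus lies
      before \<open>l\<close>. The \<open>b\<close> following it belongs to \<open>M1\<close> by the
      previous step, yet no path from row 1 reaches it.\<close>
    have "\<forall>j\<le>l. \<exists>q. l \<le> q \<and> q \<le> length w \<and> surplus w j \<le> surplus w q"
    proof (rule ccontr)
      assume "\<not> ?thesis"
      then obtain j where j: "j \<le> l" "\<And>q. l \<le> q \<Longrightarrow> q \<le> length w \<Longrightarrow> surplus w q < surplus w j"
        by (meson not_le)
      obtain p where p: "p \<le> length w" "\<And>q. q \<le> length w \<Longrightarrow> surplus w q \<le> surplus w p"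
        "\<And>q. p < q \<Longrightarrow> q \<le> length w \<Longrightarrow> surplus w q < surplus w p"
        using last_argmax[of "length w" "surplus w"] by blast
      have pl: "p < l"
        using p(2)[of j] j(1) j(2)[of p] p(1) l(1) by fastforce
      then have "surplus w (Suc p) < surplus w p"
        using p(3)[of "Suc p"] l(1) by simp
      then have wp: "w ! p = Rb"
        by (cases "w ! p") (auto simp: surplus_Suc)
      have "Suc (Suc (i + p)) \<in> index_set J Rb \<inter> arc (Suc i) k"
        using pl l wp by (auto simp: index_set_def arc_def nth_J_suffix length_J)
      then have "\<not> back_unmatched (length J) (index_set J Ra) (index_set J Rb) (Suc (Suc (i + p)))"
        using all by (auto simp: M1_def)
      then show False
        using not_matched_at_last_argmax[OF neg _ wp p(2,3)] pl l(1) by simp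
    qed
    then show "good w"
      unfolding good_def using H Hl l(1) by blast
  next
    assume good: "good w"
    then have H: "\<forall>j\<le>length w. -1 \<le> height w j"
      by (simp add: good_def)
    obtain l where l: "l \<le> length w" "height w l = -1"
      "\<And>j. j \<le> l \<Longrightarrow> \<exists>q. l \<le> q \<and> q \<le> length w \<and> surplus w j \<le> surplus w q"
      using good by (auto simp: good_def)
    define k where "k = Suc (i + l)"
    have k: "k < length J"
      using l(1) by (simp add: k_def length_J)
    have "index_set J Rb \<inter> arc (Suc i) k \<subseteq> M1"
    proof
      fix v assume v: "v \<in> index_set J Rb \<inter> arc (Suc i) k"
      have "J ! Suc i = Rc"
        by (simp add: J nth_append)
      then have "v \<noteq> Suc i" "Suc i \<le> v" "v \<le> k"
        using v by (auto simp: index_set_def arc_def k_def)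
      then obtain j where j: "v = Suc (Suc (i + j))" "j < l"
        by (intro that[of "v - Suc (Suc i)"]) (auto simp: k_def)
      \<comment> \<open>The prefix of length \<open>q\<close> ends at index
        \<open>Suc (i + q)\<close>; the arc from \<open>v\<close> to there has at least as many
        \<open>a\<close> as \<open>b\<close>, so the \<open>b\<close> at \<open>v\<close> is
        matched.\<close>
      obtain q where q: "l \<le> q" "q \<le> length w" "surplus w j \<le> surplus w q"
        using l(3)[of j] j(2) by auto
      have vJ: "v < length J" and qJ: "Suc (i + q) < length J" and vq: "v \<le> Suc (i + q)"
        using j q l(1) by (auto simp: length_J)
      have "int (card (index_set J Ra \<inter> arc v (Suc (i + q)))) - int (card (index_set J Rb \<inter> arc v (Suc (i + q)))) =
        surplus J (Suc (Suc (i + q))) - surplus J v"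
        unfolding card_index_arc[OF vJ qJ] using vq by (simp add: surplus_def del: cnt_Suc)
      also have "\<dots> \<ge> 0"
        using q(3) unfolding j(1) surplus_J_suffix by simp
      finally have "\<not> back_unmatched (length J) (index_set J Ra) (index_set J Rb) v"
        unfolding back_unmatched_def using qJ by (auto simp: not_less)
      then show "v \<in> M1"
        using v by (auto simp: M1_def)
    qed
    then have all: "M1 \<inter> arc (Suc i) k = index_set J Rb \<inter> arc (Suc i) k"
      using M1b by auto
    have "card (index_set J Rc \<inter> arc (Suc i) k) \<le> card (M1 \<inter> arc (Suc i) k)"
      unfolding all using arcB[OF l(1)] arcC[OF l(1)] l(2) unfolding k_def height_def by linarith
    then have "\<not> back_unmatched (length J) M1 (index_set J Rc) (Suc i)"
      unfolding back_unmatched_def using k by (auto simp: not_less)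
    then show "label_13 J (Suc i)"
      unfolding label_13_def M1_def[symmetric] using H back_unmatched_0_iff by simp
  qed
qed

end

section \<open>From queues to backward words\<close>

text \<open>The position in \<open>{1..N}\<close> reached from \<^term>\<open>d\<close> after \<^term>\<open>k\<close> steps backwards around the circle.\<close>

definition back_pos :: "nat \<Rightarrow> nat \<Rightarrow> nat \<Rightarrow> nat" where
  "back_pos N d k = (if k < d then d - k else d + N - k)"

lemma back_pos_0: "0 < d \<Longrightarrow> back_pos N d 0 = d"
  by (simp add: back_pos_def)

lemma bij_betw_back_pos:
  assumes "0 < d" "d \<le> N"
  shows "bij_betw (back_pos N d) {..<N} {1..N}"
proof (rule bij_betw_byWitness[where f' = "\<lambda>v. if v \<le> d then d - v else d + N - v"])
qed (use assms in \<open>auto simp: back_pos_def\<close>)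

lemma back_pos_le_iff:
  assumes "d \<le> N" "k < N"
  shows "back_pos N d k \<le> d \<longleftrightarrow> k < d"
  using assms by (auto simp: back_pos_def)

text \<open>Reversing the direction swaps the two ends of an arc.\<close>

lemma back_pos_in_arc_iff:
  assumes "d \<le> N" "j < N" "k < N" "k' < N"
  shows "back_pos N d j \<in> arc (back_pos N d k') (back_pos N d k) \<longleftrightarrow> j \<in> arc k k'"
  using assms unfolding back_pos_def arc_def
  by (cases "j < d"; cases "k < d"; cases "k' < d") auto

lemma unmatched_back_pos_iff:
  assumes d: "0 < d" "d \<le> N" and k: "k < N" and sub: "X \<subseteq> {1..N}" "Y \<subseteq> {1..N}"
  shows "unmatched {1..N} X Y (back_pos N d k) \<longleftrightarrow>
    back_unmatched N {j. j < N \<and> back_pos N d j \<in> X} {j. j < N \<and> back_pos N d j \<in> Y} k"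
proof -
  have bij: "back_pos N d ` {..<N} = {1..N}" "inj_on (back_pos N d) {..<N}"
    using bij_betw_back_pos[OF d] by (auto simp: bij_betw_def)
  have card: "card (Z \<inter> arc (back_pos N d k') (back_pos N d k)) =
      card ({j. j < N \<and> back_pos N d j \<in> Z} \<inter> arc k k')" if "k' < N" "Z \<subseteq> {1..N}" for Z k'
  proof -
    have "Z \<inter> arc (back_pos N d k') (back_pos N d k) =
        back_pos N d ` ({j. j < N \<and> back_pos N d j \<in> Z} \<inter> arc k k')" (is "?L = ?R")
    proof
      show "?L \<subseteq> ?R"
      proof
        fix v assume v: "v \<in> ?L"
        then have "v \<in> back_pos N d ` {..<N}"
          using that(2) bij(1) by auto
        then obtain j where j: "j < N" "v = back_pos N d j"
          by auto
        then have "j \<in> {j. j < N \<and> back_pos N d j \<in> Z} \<inter> arc k k'"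
          using v back_pos_in_arc_iff[OF d(2) j(1) k that(1)] by auto
        then show "v \<in> ?R"
          using j(2) by blast
      qed
      show "?R \<subseteq> ?L"
        using back_pos_in_arc_iff[OF d(2) _ k that(1)] by auto
    qed
    moreover have "inj_on (back_pos N d) ({j. j < N \<and> back_pos N d j \<in> Z} \<inter> arc k k')"
      by (rule inj_on_subset[OF bij(2)]) auto
    ultimately show ?thesis
      by (simp add: card_image)
  qed
  have "unmatched {1..N} X Y (back_pos N d k) \<longleftrightarrow>
      (\<forall>k'<N. card (X \<inter> arc (back_pos N d k') (back_pos N d k)) < card (Y \<inter> arc (back_pos N d k') (back_pos N d k)))"
    unfolding unmatched_def bij(1)[symmetric] by auto
  then show ?thesis
    unfolding back_unmatched_def using card sub by simp
qed

text \<open>Identifies an entry by its rank, which can be carried across a bijection; this is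
  applied to c_2, to c_n and to the third \<open>c\<close> of a word.\<close>

lemma nth_eq_iff_card:
  fixes xs :: "nat list"
  assumes "sorted_wrt (<) xs" "i < length xs" "v \<in> set xs"
  shows "xs ! i = v \<longleftrightarrow> card {u \<in> set xs. u \<le> v} = Suc i"
proof
  let ?c = "\<lambda>v. card {u \<in> set xs. u \<le> v}"
  have *: "?c (xs ! j) = Suc j" if "j < length xs" for j
  proof -
    have "?c (xs ! j) > j"
      using nth_le_iff_card[OF assms(1) that, of "xs ! j"] by simp
    moreover have "\<not> Suc j < ?c (xs ! j)"
    proof (cases "Suc j < length xs")
      case True
      have "xs ! j < xs ! Suc j"
        using assms(1) True by (simp add: sorted_wrt_nth_less)
      then show ?thesis
        using nth_le_iff_card[OF assms(1) True, of "xs ! j"] by simp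
    next
      case False
      have "?c (xs ! j) \<le> card (set xs)"
        by (intro card_mono) auto
      also have "\<dots> \<le> length xs"
        by (rule card_length)
      finally show ?thesis
        using False by simp
    qed
    ultimately show ?thesis
      by simp
  qed
  show "?c v = Suc i" if "xs ! i = v"
    using *[OF assms(2)] that by simp
  show "xs ! i = v" if "?c v = Suc i"
    using assms(3) * that by (metis Suc_inject in_set_conv_nth)
qed

definition letter :: "nat list \<times> nat list \<times> nat list \<Rightarrow> nat \<Rightarrow> row" where
  "letter = (\<lambda>(a, b, c) v. if v \<in> set a then Ra else if v \<in> set b then Rb else Rc)"

definition back_word :: "nat \<Rightarrow> nat list \<times> nat list \<times> nat list \<Rightarrow> row list" where
  "back_word N = (\<lambda>(a, b, c). map (\<lambda>k. letter (a, b, c) (back_pos N (c ! 1) k)) [0..<N])"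

lemma length_back_word [simp]: "length (back_word N q) = N"
  by (cases q) (simp add: back_word_def)

text \<open>The condition \<open>3 \<le> n\<close> separates c_2 from c_n and so gives
  \<open>d < N\<close>.\<close>

locale cmq =
  fixes s t n N :: nat and a b c :: "nat list"
  assumes queue: "is_cmq s t n (a, b, c)" and n: "s + t < n" "3 \<le> n"
    and N: "N = n + 2 * s + t" and last: "c ! (n - 1) = N"
begin

definition "d = c ! 1"
definition "J = back_word N (a, b, c)"

lemma rows: "length a = s" "length b = s + t" "length c = n"
  "sorted_wrt (<) a" "sorted_wrt (<) b" "sorted_wrt (<) c" "distinct a" "distinct b" "distinct c"
  "set a \<inter> set b = {}" "set a \<inter> set c = {}" "set b \<inter> set c = {}" "set a \<union> set b \<union> set c = {1..N}"
  using queue N by (auto simp: is_cmq_def)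

lemma row_subset: "set a \<subseteq> {1..N}" "set b \<subseteq> {1..N}" "set c \<subseteq> {1..N}"
  using rows(13) by blast+

lemma d_bounds: "0 < d" "d \<le> N" "d < N" "d \<in> set c" "c ! 0 \<in> set c" "c ! 0 < d" "0 < c ! 0"
proof -
  have "1 < length c"
    using rows(3) n by simp
  then show "d \<in> set c"
    unfolding d_def by (rule nth_mem)
  then show "0 < d" "d \<le> N"
    using row_subset(3) by auto
  have "d < c ! (n - 1)"
    unfolding d_def using rows(3,6) n by (intro sorted_wrt_nth_less[OF rows(6)]) auto
  then show "d < N"
    using last by simp
  have "0 < length c"
    using rows(3) n by simp
  then show "c ! 0 \<in> set c"
    by (rule nth_mem)
  then show "0 < c ! 0"
    using row_subset(3) by auto
  show "c ! 0 < d"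
    unfolding d_def using \<open>1 < length c\<close> by (intro sorted_wrt_nth_less[OF rows(6)]) auto
qed

lemma length_J: "length J = N"
  by (simp add: J_def)

lemma nth_J: "k < N \<Longrightarrow> J ! k = letter (a, b, c) (back_pos N d k)"
  by (simp add: J_def back_word_def d_def)

lemma back_pos_mem: "k < N \<Longrightarrow> back_pos N d k \<in> {1..N}"
  using bij_betw_back_pos[OF d_bounds(1,2)] by (auto simp: bij_betw_def)

lemma letter_iff:
  assumes "v \<in> {1..N}"
  shows "letter (a, b, c) v = Ra \<longleftrightarrow> v \<in> set a" "letter (a, b, c) v = Rb \<longleftrightarrow> v \<in> set b"
    "letter (a, b, c) v = Rc \<longleftrightarrow> v \<in> set c"
  using assms rows(10-12) unfolding rows(13)[symmetric] by (auto simp: letter_def)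

lemma index_sets:
  "index_set J Ra = {j. j < N \<and> back_pos N d j \<in> set a}"
  "index_set J Rb = {j. j < N \<and> back_pos N d j \<in> set b}"
  "index_set J Rc = {j. j < N \<and> back_pos N d j \<in> set c}"
  using nth_J letter_iff[OF back_pos_mem] by (auto simp: index_set_def length_J)

lemma unmatched_iff_back:
  assumes "k < N"
  shows "unmatched {1..N} (set a) (set b) (back_pos N d k) \<longleftrightarrow>
      back_unmatched N (index_set J Ra) (index_set J Rb) k"
    "unmatched {1..N} (set b) (set c) (back_pos N d k) \<longleftrightarrow>
      back_unmatched N (index_set J Rb) (index_set J Rc) k"
  unfolding index_sets using row_subset by (intro unmatched_back_pos_iff[OF d_bounds(1,2) assms]; auto)+

lemma projected_word_iff_label_13:
  "projected_word (a, b, c) ! 0 = 1 \<and> projected_word (a, b, c) ! 1 = 3 \<longleftrightarrow> label_13 J (d - c ! 0)"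
proof -
  let ?B1 = "{y \<in> set b. \<not> unmatched {1..N} (set a) (set b) y}"
  have w: "projected_word (a, b, c) ! 0 = label (a, b, c) (c ! 0)"
    "projected_word (a, b, c) ! 1 = label (a, b, c) d"
    using rows(3) n by (simp_all add: projected_word_def d_def)
  have k: "d - c ! 0 < N" "back_pos N d (d - c ! 0) = c ! 0"
    using d_bounds by (auto simp: back_pos_def)
  have B1: "{j. j < N \<and> back_pos N d j \<in> ?B1} =
      {j \<in> index_set J Rb. \<not> back_unmatched N (index_set J Ra) (index_set J Rb) j}"
    using unmatched_iff_back(1) by (auto simp: index_sets(2))
  have "label (a, b, c) (c ! 0) = 1 \<longleftrightarrow> \<not> unmatched {1..N} ?B1 (set c) (back_pos N d (d - c ! 0))"
    using label_iff(1)[OF queue n(1) d_bounds(5)] N k(2) by simp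
  also have "\<dots> \<longleftrightarrow> \<not> back_unmatched N {j. j < N \<and> back_pos N d j \<in> ?B1} (index_set J Rc) (d - c ! 0)"
    unfolding index_sets(3) using row_subset by (subst unmatched_back_pos_iff[OF d_bounds(1,2) k(1)]) auto
  finally have 1: "label (a, b, c) (c ! 0) = 1 \<longleftrightarrow> \<not> back_unmatched N
      {j \<in> index_set J Rb. \<not> back_unmatched N (index_set J Ra) (index_set J Rb) j} (index_set J Rc) (d - c ! 0)"
    unfolding B1 .
  have "label (a, b, c) d = 3 \<longleftrightarrow> unmatched {1..N} (set b) (set c) (back_pos N d 0)"
    using label_iff(2)[OF queue n(1) d_bounds(4)] N back_pos_0[OF d_bounds(1)] by simp
  also have "\<dots> \<longleftrightarrow> back_unmatched N (index_set J Rb) (index_set J Rc) 0"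
    using unmatched_iff_back(2)[of 0] d_bounds by simp
  finally show ?thesis
    unfolding w 1 label_13_def length_J by blast
qed

lemma card_index_set: "card (index_set J Ra) = s" "card (index_set J Rb) = s + t" "card (index_set J Rc) = n"
proof -
  have "card {j. j < N \<and> back_pos N d j \<in> X} = card X" if "X \<subseteq> {1..N}" for X
  proof -
    have bij: "back_pos N d ` {..<N} = {1..N}" "inj_on (back_pos N d) {..<N}"
      using bij_betw_back_pos[OF d_bounds(1,2)] by (auto simp: bij_betw_def)
    have "X = back_pos N d ` {j. j < N \<and> back_pos N d j \<in> X}"
      using that unfolding bij(1)[symmetric] by auto
    moreover have "inj_on (back_pos N d) {j. j < N \<and> back_pos N d j \<in> X}"
      by (rule inj_on_subset[OF bij(2)]) auto
    ultimately show ?thesis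
      by (metis card_image)
  qed
  then show "card (index_set J Ra) = s" "card (index_set J Rb) = s + t" "card (index_set J Rc) = n"
    unfolding index_sets using rows(1-3,7-9) row_subset by (simp_all add: distinct_card)
qed

text \<open>Read backwards from c_2, the entries of row 3 begin with c_2, c_1, c_n. Index
  \<open>d - 1\<close> is position 1 and index \<open>d\<close> is position \<open>N\<close>, which
  is c_n, so \<open>d\<close> can be recovered from the word alone.\<close>

lemma third_Rc: "d \<in> index_set J Rc" "card {k \<in> index_set J Rc. k \<le> d} = 3"
proof -
  have "back_pos N d d = N"
    by (simp add: back_pos_def)
  moreover have "N \<in> set c"
    using last rows(3) n by (metis diff_less less_le_trans nth_mem zero_less_numeral zero_less_one)
  ultimately show dJ: "d \<in> index_set J Rc"
    using d_bounds by (simp add: index_sets)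
  have bij: "back_pos N d ` {..<N} = {1..N}" "inj_on (back_pos N d) {..<N}"
    using bij_betw_back_pos[OF d_bounds(1,2)] by (auto simp: bij_betw_def)
  have "{u \<in> set c. u \<le> d} = back_pos N d ` {k \<in> index_set J Rc. k < d}"
  proof
    show "{u \<in> set c. u \<le> d} \<subseteq> back_pos N d ` {k \<in> index_set J Rc. k < d}"
    proof
      fix u assume u: "u \<in> {u \<in> set c. u \<le> d}"
      then have "u \<in> back_pos N d ` {..<N}"
        using row_subset(3) unfolding bij(1) by auto
      then obtain k where "k < N" "u = back_pos N d k"
        by auto
      then show "u \<in> back_pos N d ` {k \<in> index_set J Rc. k < d}"
        using u back_pos_le_iff[OF d_bounds(2)] by (auto simp: index_sets)
    qed
  qed (use back_pos_le_iff[OF d_bounds(2)] in \<open>auto simp: index_sets\<close>)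
  moreover have "inj_on (back_pos N d) {k \<in> index_set J Rc. k < d}"
    by (rule inj_on_subset[OF bij(2)]) (auto simp: index_sets)
  ultimately have "card {k \<in> index_set J Rc. k < d} = card {u \<in> set c. u \<le> d}"
    by (simp add: card_image)
  also have "\<dots> = 2"
    using nth_eq_iff_card[OF rows(6) _ d_bounds(4), of 1] rows(3) n by (simp add: d_def)
  moreover have "{k \<in> index_set J Rc. k \<le> d} = insert d {k \<in> index_set J Rc. k < d}"
    using dJ by auto
  ultimately show "card {k \<in> index_set J Rc. k \<le> d} = 3"
    by simp
qed

lemma Rc_before: "J ! 0 = Rc" "J ! (d - c ! 0) = Rc" "\<And>k. 0 < k \<Longrightarrow> k < d - c ! 0 \<Longrightarrow> J ! k \<noteq> Rc"
proof -
  have "back_pos N d 0 \<in> set c" "back_pos N d (d - c ! 0) \<in> set c"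
    using d_bounds by (auto simp: back_pos_def)
  then show "J ! 0 = Rc" "J ! (d - c ! 0) = Rc"
    using nth_J[of 0] nth_J[of "d - c ! 0"] letter_iff(3)[OF back_pos_mem] d_bounds by auto
  fix k assume k: "0 < k" "k < d - c ! 0"
  show "J ! k \<noteq> Rc"
  proof
    assume "J ! k = Rc"
    moreover have kd: "k < N" "k < d"
      using k d_bounds by auto
    ultimately have "back_pos N d k \<in> set c"
      using nth_J[of k] letter_iff(3)[OF back_pos_mem, of k] by simp
    then have "d - k \<in> set c"
      using kd by (simp add: back_pos_def)
    then obtain j where j: "j < length c" "c ! j = d - k"
      by (auto simp: in_set_conv_nth)
    then have "c ! 0 < c ! j" "c ! j < c ! 1"
      using k d_def by auto
    then have "j \<noteq> 0" "j \<noteq> 1"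
      by (metis less_irrefl)+
    then have "c ! 1 < c ! j"
      using j(1) by (intro sorted_wrt_nth_less[OF rows(6)]) auto
    then show False
      using \<open>c ! j < c ! 1\<close> by simp
  qed
qed

text \<open>A \<open>b\<close> strictly between c_2 and c_1 would give an arc with at least one
  \<open>b\<close> and only the single \<open>c\<close> at index 0, contradicting label 3 of
  c_2.\<close>

lemma J_decomp:
  assumes "label_13 J (d - c ! 0)"
  shows "J = Rc # replicate (d - c ! 0 - 1) Ra @ Rc # drop (Suc (d - c ! 0)) J"
proof -
  define k1 where "k1 = d - c ! 0"
  have k1: "0 < k1" "k1 < N"
    using d_bounds by (auto simp: k1_def)
  have un: "card (index_set J Rb \<inter> arc 0 k) < card (index_set J Rc \<inter> arc 0 k)" if "k < N" for k
    using assms that unfolding label_13_def back_unmatched_def length_J by blast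
  have Ra: "J ! k = Ra" if k: "0 < k" "k < k1" for k
  proof (rule ccontr)
    assume "J ! k \<noteq> Ra"
    then have "J ! k = Rb"
      using Rc_before(3) k unfolding k1_def[symmetric] by (cases "J ! k") auto
    then have "k \<in> index_set J Rb \<inter> arc 0 k"
      using k k1 by (simp add: index_set_def length_J)
    then have "0 < card (index_set J Rb \<inter> arc 0 k)"
      by (auto simp: card_gt_0_iff)
    moreover have "index_set J Rc \<inter> arc 0 k \<subseteq> {0}"
      using Rc_before(3) k unfolding k1_def[symmetric] by (fastforce simp: index_set_def arc_def)
    then have "card (index_set J Rc \<inter> arc 0 k) \<le> 1"
      by (metis card_mono finite.emptyI finite_insert is_singletonI is_singleton_altdef)
    ultimately show False
      using un[of k] k k1 by simp
  qed
  have "J = take k1 J @ J ! k1 # drop (Suc k1) J"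
    using k1 by (simp add: id_take_nth_drop length_J)
  moreover have "take k1 J = Rc # replicate (k1 - 1) Ra"
  proof (rule nth_equalityI)
    show "take k1 J ! k = (Rc # replicate (k1 - 1) Ra) ! k" if "k < length (take k1 J)" for k
      using that Ra[of k] Rc_before(1) by (cases k) auto
  qed (use k1 in \<open>simp add: length_J\<close>)
  ultimately show ?thesis
    using Rc_before(2) unfolding k1_def[symmetric] by simp
qed

lemma d_eq: "d = sorted_list_of_set (index_set J Rc) ! 2"
proof -
  have "2 < length (sorted_list_of_set (index_set J Rc))"
    using card_index_set(3) n by simp
  then show ?thesis
    using nth_eq_iff_card[of "sorted_list_of_set (index_set J Rc)" 2 d] third_Rc by simp
qed

text \<open>Together with \<open>d_eq\<close>, this reconstructs the queue from its backward word,
  which gives injectivity in the count.\<close>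

lemma rows_eq:
  "a = sorted_list_of_set (back_pos N d ` index_set J Ra)"
  "b = sorted_list_of_set (back_pos N d ` index_set J Rb)"
  "c = sorted_list_of_set (back_pos N d ` index_set J Rc)"
proof -
  have "back_pos N d ` {j. j < N \<and> back_pos N d j \<in> X} = X" if "X \<subseteq> {1..N}" for X
  proof -
    have "back_pos N d ` {..<N} = {1..N}"
      using bij_betw_back_pos[OF d_bounds(1,2)] by (simp add: bij_betw_def)
    then have "x \<in> back_pos N d ` {..<N}" if "x \<in> X" for x
      using that \<open>X \<subseteq> {1..N}\<close> by blast
    then show ?thesis
      by auto
  qed
  then show "a = sorted_list_of_set (back_pos N d ` index_set J Ra)"
    "b = sorted_list_of_set (back_pos N d ` index_set J Rb)"
    "c = sorted_list_of_set (back_pos N d ` index_set J Rc)"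
    unfolding index_sets using row_subset rows(4-6) by (simp_all add: sorted_list_of_set_eqI)
qed

end

section \<open>Every admissible word comes from a queue\<close>

lemma card_index_set_eq: "card (index_set w x) = count_list w x"
proof -
  have "index_set w x = {j. 0 \<le> j \<and> j < length w \<and> w ! j = x}"
    by (auto simp: index_set_def)
  then show ?thesis
    using card_index_interval[of 0 "length w" w x] by (simp add: cnt_length)
qed

lemma index_set_Un: "index_set J Ra \<union> index_set J Rb \<union> index_set J Rc = {..<length J}"
proof -
  have "J ! k = Ra \<or> J ! k = Rb \<or> J ! k = Rc" for k
    by (cases "J ! k") auto
  then show ?thesis
    by (auto simp: index_set_def)
qed

lemma index_set_disjoint: "x \<noteq> y \<Longrightarrow> index_set J x \<inter> index_set J y = {}"
  by (auto simp: index_set_def)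

text \<open>By \<open>third_Rc\<close> the starting position has to be the index \<open>d\<close> of
  the third \<open>c\<close>. Going backwards from \<open>d\<close>, index 0 lands on
  \<open>d\<close> and index \<open>d\<close> on \<open>N\<close>, which makes these c_2 and
  c_n.\<close>

lemma ex_cmq_back_word:
  assumes st: "s + t < n" "3 \<le> n" and N: "N = n + 2 * s + t" and len: "length J = N"
    and cnts: "count_list J Ra = s" "count_list J Rb = s + t" "count_list J Rc = n" and J0: "J ! 0 = Rc"
  shows "\<exists>a b c. cmq s t n N a b c \<and> back_word N (a, b, c) = J"
proof -
  define xs where "xs = sorted_list_of_set (index_set J Rc)"
  define d where "d = xs ! 2"
  have xs: "sorted_wrt (<) xs" "set xs = index_set J Rc" "length xs = n"
    using cnts by (simp_all add: xs_def card_index_set_eq)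
  have dJ: "d \<in> index_set J Rc"
    using xs st unfolding d_def by (metis nth_mem less_le_trans numeral_less_iff semiring_norm(78) eval_nat_numeral(3) lessI)
  then have card3: "card {k \<in> index_set J Rc. k \<le> d} = 3"
    using nth_eq_iff_card[of xs 2 d] xs st by (simp add: d_def)
  have dN: "d < N"
    using dJ len by (simp add: index_set_def)
  have "d \<noteq> 0"
  proof
    assume "d = 0"
    then have "{k \<in> index_set J Rc. k \<le> d} \<subseteq> {0}"
      by auto
    then have "card {k \<in> index_set J Rc. k \<le> d} \<le> card {0::nat}"
      by (intro card_mono) auto
    then show False
      using card3 by simp
  qed
  then have d: "0 < d" "d \<le> N"
    using dN by auto
  have bij: "back_pos N d ` {..<N} = {1..N}" "inj_on (back_pos N d) {..<N}"
    using bij_betw_back_pos[OF d] by (auto simp: bij_betw_def)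
  define X where "X x = back_pos N d ` index_set J x" for x
  have fin: "finite (X x)" for x
    by (simp add: X_def)
  have sub: "index_set J x \<subseteq> {..<N}" for x
    using len by (auto simp: index_set_def)
  have cardX: "card (X x) = count_list J x" for x
    unfolding X_def using inj_on_subset[OF bij(2) sub] by (simp add: card_image card_index_set_eq)
  have disj: "X x \<inter> X y = {}" if "x \<noteq> y" for x y
    unfolding X_def using inj_on_image_Int[OF bij(2) sub sub, of x y] index_set_disjoint[OF that] by simp
  have un: "X Ra \<union> X Rb \<union> X Rc = {1..N}"
    unfolding X_def image_Un[symmetric] index_set_Un len bij(1) ..
  define a b c where "a = sorted_list_of_set (X Ra)" and "b = sorted_list_of_set (X Rb)"
    and "c = sorted_list_of_set (X Rc)"
  have sets: "set a = X Ra" "set b = X Rb" "set c = X Rc"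
    by (simp_all add: a_def b_def c_def fin)
  have c: "sorted_wrt (<) c" "length c = n"
    by (simp_all add: c_def cardX cnts)
  have isq: "is_cmq s t n (a, b, c)"
    unfolding is_cmq_def using disj[of Ra Rb] disj[of Ra Rc] disj[of Rb Rc] un sets
    by (simp add: a_def b_def c_def cardX cnts N fin Un_assoc Int_Un_distrib)
  have NX: "N \<in> X Rc"
    using dJ unfolding X_def by (intro image_eqI[of _ _ d]) (auto simp: back_pos_def)
  have "{u \<in> set c. u \<le> N} = X Rc"
    using sets un by auto
  then have last: "c ! (n - 1) = N"
    using nth_eq_iff_card[OF c(1), of "n - 1" N] c(2) st NX sets cardX cnts by simp
  \<comment> \<open>Indices below \<open>d\<close> are those that land on positions at most
    \<open>d\<close>. They carry exactly two letters \<open>c\<close>, so \<open>d\<close> becomes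
    the second entry of row 3.\<close>
  have "{u \<in> set c. u \<le> d} = back_pos N d ` {k \<in> index_set J Rc. k < d}"
    unfolding sets X_def using sub[of Rc] back_pos_le_iff[OF d(2)] by auto
  moreover have "inj_on (back_pos N d) {k \<in> index_set J Rc. k < d}"
    by (rule inj_on_subset[OF bij(2)]) (use sub[of Rc] in auto)
  ultimately have "card {u \<in> set c. u \<le> d} = card {k \<in> index_set J Rc. k < d}"
    by (simp add: card_image)
  moreover have "{k \<in> index_set J Rc. k \<le> d} = insert d {k \<in> index_set J Rc. k < d}"
    using dJ by auto
  ultimately have "card {u \<in> set c. u \<le> d} = 2"
    using card3 by simp
  moreover have "0 \<in> index_set J Rc"
    using J0 len d by (simp add: index_set_def)
  then have "d \<in> set c"
    unfolding sets X_def using back_pos_0[OF d(1), of N] by (metis image_eqI)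
  ultimately have c1: "c ! 1 = d"
    using nth_eq_iff_card[OF c(1), of 1 d] c(2) st by simp
  interpret cmq s t n N a b c
    using isq st N last by unfold_locales auto
  have "back_word N (a, b, c) = J"
  proof (rule nth_equalityI)
    fix k assume "k < length (back_word N (a, b, c))"
    then have k: "k < N"
      by simp
    have mem: "back_pos N d k \<in> X (J ! k)"
      using k len by (auto simp: X_def index_set_def)
    have "letter (a, b, c) (back_pos N d k) = J ! k"
      using mem disj[of Ra Rb] disj[of Ra Rc] disj[of Rb Rc] sets
      by (cases "J ! k") (auto simp: letter_def)
    then show "back_word N (a, b, c) ! k = J ! k"
      using k c1 by (simp add: back_word_def)
  qed (simp add: len)
  then show ?thesis
    using cmq_axioms by blast
qed

text \<open>The map \<open>h\<close> strips the prefix \<open>c a^i c\<close> from the backward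
  word; the two removed letters \<open>c\<close> explain \<open>n - 1 - 1\<close>. The condition
  \<open>1 \<le> t\<close> makes row 1 shorter than row 2, as \<open>label_13_iff_good\<close>
  requires.\<close>

lemma num_cmq_13_eq_card_good:
  assumes st: "1 \<le> t" "s + t < n" "3 \<le> n"
  shows "num_cmq 1 3 s t n = card {(i, w). count_list w Ra + i = s \<and> count_list w Rb = s + t \<and>
    count_list w Rc = n - 1 - 1 \<and> good w}" (is "_ = card ?S")
proof -
  define N where "N = n + 2 * s + t"
  define Q where "Q = {(a, b, c). is_cmq s t n (a, b, c) \<and> c ! (n - 1) = N \<and>
     projected_word (a, b, c) ! 0 = 1 \<and> projected_word (a, b, c) ! 1 = 3}"
  define gap where "gap = (\<lambda>(a :: nat list, b :: nat list, c :: nat list). c ! 1 - c ! 0)"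
  define h where "h q = (gap q - 1, drop (Suc (gap q)) (back_word N q))" for q
  have Q: "q \<in> Q \<longleftrightarrow> (\<exists>a b c. q = (a, b, c) \<and> cmq s t n N a b c \<and> label_13 (back_word N q) (gap q))" for q
  proof -
    obtain a b c where q: "q = (a, b, c)"
      by (cases q)
    have "q \<in> Q \<longleftrightarrow> cmq s t n N a b c \<and> projected_word (a, b, c) ! 0 = 1 \<and> projected_word (a, b, c) ! 1 = 3"
      using st by (auto simp: Q_def q cmq_def N_def)
    also have "\<dots> \<longleftrightarrow> cmq s t n N a b c \<and> label_13 (back_word N q) (gap q)"
      using cmq.projected_word_iff_label_13[of s t n N a b c] cmq.J_def[of s t n N a b c]
        cmq.d_def[of s t n N a b c] by (auto simp: q gap_def)
    finally show ?thesis
      using q by auto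
  qed
  have decomp: "back_word N q = Rc # replicate (fst (h q)) Ra @ Rc # snd (h q)" "gap q = Suc (fst (h q))"
    if qQ: "q \<in> Q" for q
  proof -
    obtain a b c where q: "q = (a, b, c)" "cmq s t n N a b c" "label_13 (back_word N q) (gap q)"
      using qQ Q by blast
    interpret cmq s t n N a b c
      by (rule q(2))
    have "gap q = d - c ! 0"
      by (simp add: gap_def q d_def)
    then show "back_word N q = Rc # replicate (fst (h q)) Ra @ Rc # snd (h q)" "gap q = Suc (fst (h q))"
      using J_decomp q(3) d_bounds(6) unfolding J_def h_def q(1) by auto
  qed
  have "bij_betw h Q ?S"
    unfolding bij_betw_def
  proof
    show "inj_on h Q"
    proof (rule inj_onI)
      fix q q' assume qq': "q \<in> Q" "q' \<in> Q" "h q = h q'"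
      then have eq: "back_word N q = back_word N q'"
        using decomp(1) by metis
      obtain a b c a' b' c' where q: "q = (a, b, c)" "cmq s t n N a b c"
        and q': "q' = (a', b', c')" "cmq s t n N a' b' c'"
        using qq' Q by metis
      have J: "cmq.J N a b c = cmq.J N a' b' c'"
        using eq by (simp add: cmq.J_def[OF q(2)] cmq.J_def[OF q'(2)] q(1) q'(1))
      have d: "cmq.d c = cmq.d c'"
        using cmq.d_eq[OF q(2)] cmq.d_eq[OF q'(2)] J by simp
      show "q = q'"
        using cmq.rows_eq[OF q(2)] cmq.rows_eq[OF q'(2)] J d by (simp add: q(1) q'(1))
    qed
    show "h ` Q = ?S"
    proof
      show "h ` Q \<subseteq> ?S"
      proof
        fix x assume "x \<in> h ` Q"
        then obtain q where qx: "q \<in> Q" "x = h q"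
          by blast
        obtain a b c where q: "q = (a, b, c)" "cmq s t n N a b c" "label_13 (back_word N q) (gap q)"
          using qx(1) Q by blast
        interpret cmq s t n N a b c
          by (rule q(2))
        obtain i w where hq: "h q = (i, w)"
          by (cases "h q")
        have J: "J = Rc # replicate i Ra @ Rc # w" "gap q = Suc i"
          using decomp[OF qx(1)] hq by (simp_all add: J_def q(1))
        have cr: "count_list (replicate i x) y = (if x = y then i else 0)" for x y :: row
          by (induction i) auto
        have cl: "count_list J Ra = s" "count_list J Rb = s + t" "count_list J Rc = n"
          using card_index_set by (simp_all add: card_index_set_eq)
        then have "good w"
          using label_13_iff_good[OF J(1)] q(3) J(2) st by (simp add: J_def q(1))
        then show "x \<in> ?S"
          using cl unfolding J(1) qx(2) hq by (auto simp: cr)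
      qed
      show "?S \<subseteq> h ` Q"
      proof
        fix x assume "x \<in> ?S"
        then obtain i w where w: "x = (i, w)" "count_list w Ra + i = s" "count_list w Rb = s + t"
          "count_list w Rc = n - 1 - 1" "good w"
          by auto
        define J where "J = Rc # replicate i Ra @ Rc # w"
        have cr: "count_list (replicate i x) y = (if x = y then i else 0)" for x y :: row
          by (induction i) auto
        have cl: "count_list J Ra = s" "count_list J Rb = s + t" "count_list J Rc = n"
          using w st by (simp_all add: J_def cr)
        have len: "length J = N"
          using cl length_eq_count_list[of J] by (simp add: N_def)
        obtain a b c where q: "cmq s t n N a b c" "back_word N (a, b, c) = J"
          using ex_cmq_back_word[OF st(2,3) N_def len cl] by (auto simp: J_def)
        interpret C: cmq s t n N a b c
          by (rule q(1))
        have CJ: "C.J = J"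
          by (simp add: C.J_def q(2))
        define k where "k = gap (a, b, c)"
        have k: "k = C.d - c ! 0" "0 < k" "k < N"
          using C.d_bounds by (auto simp: k_def gap_def C.d_def)
        \<comment> \<open>Both \<open>k\<close> and \<open>Suc i\<close> are the index of the second
          \<open>c\<close> of \<open>J\<close>, so the queue just obtained has the gap prescribed by
          \<open>i\<close>.\<close>
        have "\<not> k < Suc i"
        proof
          assume "k < Suc i"
          then have "J ! k = Ra"
            using k(2) by (cases k) (auto simp: J_def nth_append)
          then show False
            using C.Rc_before(2) k CJ by simp
        qed
        moreover have "\<not> Suc i < k"
        proof
          assume "Suc i < k"
          moreover have "J ! Suc i = Rc"
            by (simp add: J_def nth_append)
          ultimately show False
            using C.Rc_before(3)[of "Suc i"] k CJ by simp
        qed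
        ultimately have ki: "k = Suc i"
          by simp
        then have "label_13 J k"
          using label_13_iff_good[OF J_def] cl st w(5) by simp
        then have "(a, b, c) \<in> Q"
          using Q q by (auto simp: k_def)
        moreover have "h (a, b, c) = x"
          unfolding h_def k_def[symmetric] q(2) ki w(1) by (simp add: J_def)
        ultimately show "x \<in> h ` Q"
          by blast
      qed
    qed
  qed
  then have "card Q = card ?S"
    by (rule bij_betw_same_card)
  then show ?thesis
    by (simp add: num_cmq_def Q_def N_def)
qed

theorem theorem4p3:
  fixes s t n N :: nat
  assumes "s \<ge> 1" and "t \<ge> 1" and "n > s + t" and "N = n + 2 * s + t"
  shows "num_cmq 1 3 s t n = ((N - 1) choose (s - 1)) * num_syt2 (n - 1) (s + t)"
proof -
  \<comment> \<open>The assumptions \<open>s \<ge> 1\<close>, \<open>t \<ge> 1\<close> and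
    \<open>n > s + t\<close> give \<open>3 \<le> n\<close>.\<close>
  have "num_cmq 1 3 s t n = card {(i, w). count_list w Ra + i = s \<and> count_list w Rb = s + t \<and>
      count_list w Rc = n - 1 - 1 \<and> good w}"
    using assms by (intro num_cmq_13_eq_card_good) auto
  also have "\<dots> = card {(i, w). count_list w Ra + i = s - 1 \<and> count_list w Rb = s + t \<and>
      count_list w Rc = n - 1 \<and> ballot w}"
    using assms by (intro card_good_eq_card_ballot) auto
  also have "\<dots> = ((s - 1 + (n - 1) + (s + t) + 1) choose (s - 1)) * num_syt2 (n - 1) (s + t)"
    using assms by (intro card_ballot) auto
  also have "s - 1 + (n - 1) + (s + t) + 1 = N - 1"
    using assms by simp
  finally show ?thesis .
qed

end
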